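(* Let $\mathcal{P}\subset\mathbb{R}^d$ be a lattice polytope and let $\lambda=(\lambda_1,\dots,\lambda_d)\in\mathbb{Z}^d$ define an integral form $\lambda(\mathbf m)=\lambda_1m_1+\dots+\lambda_dm_d$ that is generic and positive with respect to $\mathcal{P}$. Then for every positive integer $t$, \[ \operatorname{ehr}_{\mathcal P}^\lambda(q,t) \;=\; \sum_{\mathbf v \text{ vertex of } \mathcal P} \rho_{\mathbf v}^\lambda(q)\,\bigl((q-1)[t]_q+1\bigr)^{\lambda(\mathbf v)} . \] Consequently, the polynomial $\chi_{\mathcal P}^\lambda(q,x)=\sum_{\mathbf v}\rho_{\mathbf v}^\lambda(q)\bigl((q-1)x+1\bigr)^{\lambda(\mathbf v)}\in\mathbb{Q}(q)[x]$ satisfies $\chi_{\mathcal P}^\lambda(q,[t]_q)=\operatorname{ehr}_{\mathcal P}^\lambda(q,t)$ for all positive integers $t$.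
   Context: A lattice polytope is the convex hull of finitely many points of $\mathbb{Z}^d$. Two vertices are adjacent if they form an edge. The form $\lambda$ is generic and positive with respect to $\mathcal P$ if $\lambda(\mathbf v)\neq\lambda(\mathbf w)$ for all adjacent vertices $\mathbf v,\mathbf w$ and $\lambda(\mathbf v)\ge 0$ for every vertex $\mathbf v$. Define $[t]_q=\frac{q^t-1}{q-1}$ and $\operatorname{ehr}_{\mathcal P}^\lambda(q,t)=\sum_{\mathbf m\in t\mathcal P\cap\mathbb{Z}^d} q^{\lambda(\mathbf m)}$. For a vertex $\mathbf v$, let $\mathcal K_{\mathbf v}=\sum_{\mathbf w \text{ adjacent to }\mathbf v}\mathbb{R}_{\ge0}(\mathbf w-\mathbf v)$ (a rational cone with apex at the origin). For $S\subset\mathbb{R}^d$, the integer-point transform is $\sigma_S(\mathbf z)=\sum_{\mathbf m\in S\cap\mathbb{Z}^d}\mathbf z^{\mathbf m}$, $\mathbf z^{\mathbf m}=z_1^{m_1}\cdots z_d^{m_d}$; for a rational cone this is a rational function in $\mathbf z$. Set $\rho_{\mathbf v}^\lambda(q)=\sigma_{\mathcal K_{\mathbf v}}(q^{\lambda_1},\dots,q^{\lambda_d})$, the specialization of this rational function (well defined under the genericity assumption). *)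

theory Defs
  imports
    "HOL-Analysis.Analysis"
    "HOL-Computational_Algebra.Computational_Algebra"
    "HOL-Library.Poly_Mapping"
begin

text \<open>
  Coordinates of \<open>\<real>\<^sup>d\<close> are indexed by a finite linearly ordered type \<open>'n\<close> (think \<open>{1..d}\<close>).  The
  order plays no mathematical role; it is what makes the ring of Laurent polynomials an instance
  of \<^class>\<open>idom\<close>, so that its field of fractions is available.
\<close>

definition lattice_points :: "(real^'n) set" where
  "lattice_points = {x. \<forall>i. x $ i \<in> \<int>}"

definition lattice_polytope :: "(real^'n) set \<Rightarrow> bool" where
  "lattice_polytope P \<longleftrightarrow> (\<exists>V. finite V \<and> V \<subseteq> lattice_points \<and> P = convex hull V)"

definition vertices :: "(real^'n) set \<Rightarrow> (real^'n) set" where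
  "vertices P = {v. v extreme_point_of P}"

definition adjacent_vertices :: "(real^'n) set \<Rightarrow> real^'n \<Rightarrow> real^'n \<Rightarrow> bool" where
  "adjacent_vertices P v w \<longleftrightarrow>
     v \<in> vertices P \<and> w \<in> vertices P \<and> closed_segment v w edge_of P"

definition form :: "int^'n \<Rightarrow> real^'n \<Rightarrow> real" where
  "form l x = (\<Sum>i\<in>UNIV. of_int (l $ i) * x $ i)"

definition generic_positive :: "int^'n \<Rightarrow> (real^'n) set \<Rightarrow> bool" where
  "generic_positive l P \<longleftrightarrow>
     (\<forall>v w. adjacent_vertices P v w \<longrightarrow> form l v \<noteq> form l w) \<and>
     (\<forall>v\<in>vertices P. form l v \<ge> 0)"

definition vertex_cone :: "(real^'n) set \<Rightarrow> real^'n \<Rightarrow> (real^'n) set" where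
  "vertex_cone P v =
     {\<Sum>w | adjacent_vertices P v w. c w *\<^sub>R (w - v) | c. \<forall>w. 0 \<le> c w}"


subsection \<open>Integer-point transforms as rational functions\<close>

text \<open>
  A Laurent polynomial over \<open>\<rat>\<close> is a finitely supported map from exponent vectors in \<open>\<int>\<^sup>d\<close> to
  coefficients; multiplication is convolution.
\<close>

type_synonym 'n laurent_poly = "('n \<Rightarrow>\<^sub>0 int) \<Rightarrow>\<^sub>0 rat"

definition exponent_vec :: "('n::finite \<Rightarrow>\<^sub>0 int) \<Rightarrow> real^'n" where
  "exponent_vec m = (\<chi> i. of_int (Poly_Mapping.lookup m i))"

text \<open>
  The coefficient function of the formal series \<open>\<Sum>m\<in>S \<inter> \<int>\<^sup>d. z\<^sup>m\<close>, and the action of Laurent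
  polynomials on such (in general infinite in all directions) formal series.
\<close>

definition point_series :: "(real^'n) set \<Rightarrow> ('n::finite \<Rightarrow>\<^sub>0 int) \<Rightarrow> rat" where
  "point_series S m = (if exponent_vec m \<in> S then 1 else 0)"

definition series_mult :: "'n laurent_poly \<Rightarrow> (('n \<Rightarrow>\<^sub>0 int) \<Rightarrow> rat) \<Rightarrow> ('n \<Rightarrow>\<^sub>0 int) \<Rightarrow> rat" where
  "series_mult g s m = (\<Sum>a\<in>Poly_Mapping.keys g. Poly_Mapping.lookup g a * s (m - a))"

text \<open>
  The rational function \<open>f / g\<close> represented by the series: \<open>g \<cdot> \<Sum>m\<in>S \<inter> \<int>\<^sup>d. z\<^sup>m = f\<close> with \<open>g \<noteq> 0\<close>.
  There is at most one such rational function for any \<open>S\<close>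
  (lemma \<open>integer_point_transform_eqI\<close> below).
\<close>

definition integer_point_transform ::
    "(real^('n::{finite,linorder})) set \<Rightarrow> ('n::{finite,linorder}) laurent_poly fract" where
  "integer_point_transform S =
     (THE R. \<exists>f g. g \<noteq> 0 \<and> series_mult g (point_series S) = Poly_Mapping.lookup f \<and>
        R = Fraction_Field.Fract f g)"

lemma series_mult_eq_sum:
  assumes "finite A" "Poly_Mapping.keys g \<subseteq> A"
  shows "series_mult g s m = (\<Sum>a\<in>A. Poly_Mapping.lookup g a * s (m - a))"
  unfolding series_mult_def using assms
  by (intro sum.mono_neutral_left) (auto simp: in_keys_iff)

lemma series_mult_add: "series_mult (g + h) s m = series_mult g s m + series_mult h s m"
proof -
  let ?A = "Poly_Mapping.keys g \<union> Poly_Mapping.keys h"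
  have "Poly_Mapping.keys (g + h) \<subseteq> ?A" by (rule Poly_Mapping.keys_add)
  then show ?thesis
    by (simp add: series_mult_eq_sum[of ?A] lookup_add distrib_right sum.distrib)
qed

lemma series_mult_single: "series_mult (Poly_Mapping.single a c) s m = c * s (m - a)"
  by (simp add: series_mult_eq_sum[of "{a}"])

lemma poly_mapping_single_induct [case_names single add]:
  assumes "\<And>a c. Q (Poly_Mapping.single a c)" and "\<And>f g. Q f \<Longrightarrow> Q g \<Longrightarrow> Q (f + g)"
  shows "Q (f :: 'a \<Rightarrow>\<^sub>0 'b::comm_monoid_add)"
proof -
  have "Q (\<Sum>a\<in>A. Poly_Mapping.single a (Poly_Mapping.lookup f a))" if "finite A" for A
    using that
  proof (induction A rule: finite_induct)
    case empty
    then show ?case using assms(1)[of undefined 0] by simp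
  qed (simp add: assms)
  moreover have "(\<Sum>a\<in>Poly_Mapping.keys f. Poly_Mapping.single a (Poly_Mapping.lookup f a)) = f"
    by (rule poly_mapping_eqI)
      (auto simp: lookup_sum lookup_single when_def in_keys_iff sum.delta)
  ultimately show ?thesis by (metis finite_keys)
qed

lemma series_mult_mult: "series_mult (g * h) s m = series_mult g (series_mult h s) m"
proof (induction g arbitrary: m rule: poly_mapping_single_induct)
  case (single a c)
  show ?case
  proof (induction h arbitrary: m rule: poly_mapping_single_induct)
    case (single b d)
    show ?case by (simp add: mult_single series_mult_single algebra_simps)
  next
    case (add f g)
    then show ?case
      by (simp add: distrib_left series_mult_add series_mult_single)
  qed
next
  case (add f g)
  then show ?case by (simp add: distrib_right series_mult_add)
qed

lemma series_mult_lookup: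
  "series_mult g (Poly_Mapping.lookup f) = Poly_Mapping.lookup (g * f)"
proof
  fix m
  let ?one = "\<lambda>k. if k = 0 then 1 else (0::rat)"
  have eq: "series_mult h ?one = Poly_Mapping.lookup h" for h :: "'a laurent_poly"
  proof
    fix m
    show "series_mult h ?one m = Poly_Mapping.lookup h m"
      by (induction h rule: poly_mapping_single_induct)
        (auto simp: series_mult_single series_mult_add lookup_add lookup_single when_def)
  qed
  show "series_mult g (Poly_Mapping.lookup f) m = Poly_Mapping.lookup (g * f) m"
    using series_mult_mult[of g f ?one m] by (simp add: eq)
qed

lemma integer_point_transform_eqI:
  fixes S :: "(real^'n::{finite,linorder}) set"
  assumes "g \<noteq> 0" and gf: "series_mult g (point_series S) = Poly_Mapping.lookup f"
  shows "integer_point_transform S = Fraction_Field.Fract f g"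
  unfolding integer_point_transform_def
proof (rule the_equality)
  show "\<exists>f' g'. g' \<noteq> 0 \<and> series_mult g' (point_series S) = Poly_Mapping.lookup f' \<and>
      Fraction_Field.Fract f g = Fraction_Field.Fract f' g'"
    using assms by blast
next
  fix R
  assume "\<exists>f' g'. g' \<noteq> 0 \<and> series_mult g' (point_series S) = Poly_Mapping.lookup f' \<and>
      R = Fraction_Field.Fract f' g'"
  then obtain f' g' where *: "g' \<noteq> 0" "series_mult g' (point_series S) = Poly_Mapping.lookup f'"
    "R = Fraction_Field.Fract f' g'" by blast
  have "Poly_Mapping.lookup (g' * f) = series_mult (g' * g) (point_series S)"
    using gf by (auto simp: series_mult_mult series_mult_lookup[symmetric])
  also have "\<dots> = series_mult (g * g') (point_series S)"
    by (simp add: mult.commute)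
  also have "\<dots> = Poly_Mapping.lookup (g * f')"
    using *(2) by (auto simp: series_mult_mult series_mult_lookup[symmetric])
  finally have "g' * f = g * f'"
    by simp
  then show "R = Fraction_Field.Fract f g"
    using * assms(1) by (simp add: eq_fract mult.commute)
qed


subsection \<open>Specialization\<close>

definition rat_const :: "rat \<Rightarrow> rat poly fract" where
  "rat_const c = to_fract [:c:]"

definition qvar :: "rat poly fract" where
  "qvar = to_fract [:0, 1:]"

definition laurent_eval :: "('n::finite \<Rightarrow> rat poly fract) \<Rightarrow> 'n laurent_poly \<Rightarrow> rat poly fract" where
  "laurent_eval z f =
     (\<Sum>m\<in>Poly_Mapping.keys f. rat_const (Poly_Mapping.lookup f m) * (\<Prod>i\<in>UNIV. z i powi Poly_Mapping.lookup m i))"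

text \<open>
  The value of a rational function at a point with nonzero coordinates at which it is regular,
  that is, where some representation of it has a nonvanishing denominator.
  It does not depend on that representation (lemma \<open>ratfun_eval_Fract\<close> below).
\<close>

definition ratfun_eval ::
    "(('n::{finite,linorder}) \<Rightarrow> rat poly fract) \<Rightarrow> ('n::{finite,linorder}) laurent_poly fract \<Rightarrow> rat poly fract" where
  "ratfun_eval z R =
     (THE r. \<exists>f g. R = Fraction_Field.Fract f g \<and> laurent_eval z g \<noteq> 0 \<and>
        r = laurent_eval z f / laurent_eval z g)"

lemma rat_const_add: "rat_const (c + d) = rat_const c + rat_const d"
  by (simp add: rat_const_def flip: to_fract_add)

lemma rat_const_mult: "rat_const (c * d) = rat_const c * rat_const d"
  by (simp add: rat_const_def flip: to_fract_mult)

lemma rat_const_0 [simp]: "rat_const 0 = 0"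
  by (simp add: rat_const_def)

lemma laurent_eval_eq_sum:
  assumes "finite A" "Poly_Mapping.keys g \<subseteq> A"
  shows "laurent_eval z g =
    (\<Sum>m\<in>A. rat_const (Poly_Mapping.lookup g m) * (\<Prod>i\<in>UNIV. z i powi Poly_Mapping.lookup m i))"
  unfolding laurent_eval_def using assms
  by (intro sum.mono_neutral_left) (auto simp: in_keys_iff)

lemma laurent_eval_add: "laurent_eval z (g + h) = laurent_eval z g + laurent_eval z h"
proof -
  let ?A = "Poly_Mapping.keys g \<union> Poly_Mapping.keys h"
  have "Poly_Mapping.keys (g + h) \<subseteq> ?A" by (rule Poly_Mapping.keys_add)
  then show ?thesis
    by (simp add: laurent_eval_eq_sum[of ?A] lookup_add rat_const_add distrib_right sum.distrib)
qed

lemma laurent_eval_single: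
  "laurent_eval z (Poly_Mapping.single m c) =
     rat_const c * (\<Prod>i\<in>UNIV. z i powi Poly_Mapping.lookup m i)"
  by (simp add: laurent_eval_eq_sum[of "{m}"])

lemma laurent_eval_mult:
  assumes "\<And>i. z i \<noteq> 0"
  shows "laurent_eval z (g * h) = laurent_eval z g * laurent_eval z h"
proof (induction g rule: poly_mapping_single_induct)
  case (single a c)
  show ?case
  proof (induction h rule: poly_mapping_single_induct)
    case (single b d)
    show ?case
      using assms
      by (simp add: mult_single laurent_eval_single rat_const_mult lookup_add power_int_add
          prod.distrib)
  next
    case (add f g)
    then show ?case by (simp add: distrib_left laurent_eval_add)
  qed
next
  case (add f g)
  then show ?case by (simp add: distrib_right laurent_eval_add)
qed

lemma ratfun_eval_Fract:
  assumes z: "\<And>i. z i \<noteq> 0" and g: "laurent_eval z g \<noteq> 0"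
  shows "ratfun_eval z (Fraction_Field.Fract f g) = laurent_eval z f / laurent_eval z g"
  unfolding ratfun_eval_def
proof (rule the_equality)
  fix r
  assume "\<exists>f' g'. Fraction_Field.Fract f g = Fraction_Field.Fract f' g' \<and> laurent_eval z g' \<noteq> 0 \<and>
    r = laurent_eval z f' / laurent_eval z g'"
  then obtain f' g' where *: "Fraction_Field.Fract f g = Fraction_Field.Fract f' g'"
    "laurent_eval z g' \<noteq> 0" "r = laurent_eval z f' / laurent_eval z g'" by blast
  have "g \<noteq> 0" "g' \<noteq> 0" using g *(2) by (auto simp: laurent_eval_def)
  then have "f * g' = f' * g" using *(1) by (simp add: eq_fract)
  then have "laurent_eval z f * laurent_eval z g' = laurent_eval z f' * laurent_eval z g"
    by (simp flip: laurent_eval_mult[OF z])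
  then show "r = laurent_eval z f / laurent_eval z g"
    using g * by (simp add: frac_eq_eq)
qed (use g in blast)

definition rho ::
    "(real^('n::{finite,linorder})) set \<Rightarrow> int^('n::{finite,linorder}) \<Rightarrow> real^('n::{finite,linorder}) \<Rightarrow> rat poly fract" where
  "rho P l v = ratfun_eval (\<lambda>i. qvar powi (l $ i)) (integer_point_transform (vertex_cone P v))"


subsection \<open>Weighted Ehrhart sums\<close>

definition qbracket :: "nat \<Rightarrow> rat poly fract" where
  "qbracket t = (qvar ^ t - 1) / (qvar - 1)"

text \<open>Below, \<open>form l\<close> is only rounded where its value is an integer.\<close>

definition ehr :: "(real^'n) set \<Rightarrow> int^'n \<Rightarrow> nat \<Rightarrow> rat poly fract" where
  "ehr P l t =
     (\<Sum>m \<in> ((*\<^sub>R) (real t) ` P) \<inter> lattice_points. qvar powi \<lfloor>form l m\<rfloor>)"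

text \<open>
  The exponent \<open>\<lambda>(v)\<close> is a nonnegative integer when \<open>l\<close> is positive with respect to the lattice polytope \<open>P\<close>.
\<close>

definition chi :: "(real^('n::{finite,linorder})) set \<Rightarrow> int^('n::{finite,linorder}) \<Rightarrow> rat poly fract poly" where
  "chi P l = (\<Sum>v\<in>vertices P. smult (rho P l v) ([:1, qvar - 1:] ^ nat \<lfloor>form l v\<rfloor>))"

end

theory Submission
  imports Defs
begin

text \<open>
  Let \<open>V\<close> be the vertex set and \<open>z\<^sup>v\<close> the monomial of \<open>v \<in> V\<close>.  Multiplying the series of the cone
  at \<open>v\<close> by the product of the \<open>z\<^sup>v - z\<^sup>w\<close> over the other vertices \<open>w\<close> produces coefficients that are
  alternating sums over subsets \<open>I\<close> of the generators \<open>w - v\<close>, the term of \<open>I\<close> recording whether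
  some nonnegative combination of the generators representing the given point has coefficients at
  least \<open>1\<close> on \<open>I\<close>.  Such a sum is the reduced Euler characteristic of the nerve of a family of
  half-spaces, and it vanishes when they cover the convex set of all representations.  Hence it
  does not change when the sum of the coefficients is bounded by any \<open>N \<ge> card V - 1\<close>, which replaces
  the cone by the dilates \<open>(N - card I) P\<close>.  So \<open>z\<^sup>t\<^sup>v\<close> times the cone transform is a Lagrange basis
  polynomial with nodes \<open>z\<^sup>w\<close>, with its powers \<open>X\<^sup>k\<close> replaced by the lattice point polynomials of
  \<open>(t + k) P\<close>; the basis polynomials sum to \<open>1\<close>, which gives Brion's identity in the field of
  fractions.  The same vanishing argument applied to the edge generators only shows that the
  product over the neighbours of \<open>v\<close> already is a denominator of the cone transform; it does not
  vanish under the specialization, so Brion's identity can be specialized term by term.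
\<close>

subsection \<open>Nerves of half-spaces covering a convex set\<close>

text \<open>Spelled out pointwise, because the elements are coefficient families given as plain
  functions on an arbitrary index type.\<close>

definition fun_convex :: "('b \<Rightarrow> real) set \<Rightarrow> bool" where
  "fun_convex Q \<longleftrightarrow> (\<forall>c\<in>Q. \<forall>d\<in>Q. \<forall>u\<in>{0..1}. (\<lambda>i. (1 - u) * c i + u * d i) \<in> Q)"

definition fun_affine :: "(('b \<Rightarrow> real) \<Rightarrow> real) \<Rightarrow> bool" where
  "fun_affine L \<longleftrightarrow> (\<forall>c d u. L (\<lambda>i. (1 - u) * c i + u * d i) = (1 - u) * L c + u * L d)"

text \<open>
  The alternating sum over all subsets, the empty one included, whose half-spaces \<open>c i \<ge> 1\<close> have a
  common point in \<open>Q\<close>: up to sign the reduced Euler characteristic of the nerve.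
\<close>

definition nerve_sum :: "'b set \<Rightarrow> ('b \<Rightarrow> real) set \<Rightarrow> rat" where
  "nerve_sum W Q = (\<Sum>I\<in>Pow W. (-1) ^ card I * of_bool (\<exists>c\<in>Q. \<forall>i\<in>I. 1 \<le> c i))"

lemma fun_affine_apply: "fun_affine (\<lambda>c. c i)"
  by (simp add: fun_affine_def)

lemma fun_affine_sum: "fun_affine (\<lambda>c. \<Sum>i\<in>W. c i)"
  by (simp add: fun_affine_def sum.distrib sum_distrib_left)

lemma fun_convexD:
  "fun_convex Q \<Longrightarrow> c \<in> Q \<Longrightarrow> d \<in> Q \<Longrightarrow> 0 \<le> u \<Longrightarrow> u \<le> 1 \<Longrightarrow> (\<lambda>i. (1 - u) * c i + u * d i) \<in> Q"
  by (simp add: fun_convex_def)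

lemma fun_affineD: "fun_affine L \<Longrightarrow> L (\<lambda>i. (1 - u) * c i + u * d i) = (1 - u) * L c + u * L d"
  by (simp add: fun_affine_def)

lemma affine_comb_ge:
  fixes x y :: real
  assumes "a \<le> x" "a \<le> y" "0 \<le> u" "u \<le> 1"
  shows "a \<le> (1 - u) * x + u * y"
proof -
  have "(1 - u) * a + u * a \<le> (1 - u) * x + u * y"
    using assms by (intro add_mono mult_left_mono) auto
  then show ?thesis by (simp add: algebra_simps)
qed

lemma affine_comb_le:
  fixes x y :: real
  assumes "x \<le> a" "y \<le> a" "0 \<le> u" "u \<le> 1"
  shows "(1 - u) * x + u * y \<le> a"
proof -
  have "(1 - u) * x + u * y \<le> (1 - u) * a + u * a"
    using assms by (intro add_mono mult_left_mono) auto
  then show ?thesis by (simp add: algebra_simps)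
qed

lemma fun_convex_restrict:
  assumes "fun_convex Q" "fun_affine L"
  shows "fun_convex {c\<in>Q. a \<le> L c}" "fun_convex {c\<in>Q. L c \<le> a}" "fun_convex {c\<in>Q. L c = a}"
  using assms(1)
  by (auto simp: fun_convex_def fun_affineD[OF assms(2)] affine_comb_ge affine_comb_le
      simp flip: distrib_right)

text \<open>Additivity of the Euler characteristic under cutting by a hyperplane. If both closed
  sides are met, the intermediate value on a segment of \<open>Q\<close> meets the hyperplane;
  otherwise the hyperplane is missed.\<close>

lemma nonempty_split:
  assumes "fun_convex Q" "fun_affine L"
  shows "(of_bool (\<exists>c. c \<in> Q) :: rat) = of_bool (\<exists>c\<in>Q. a \<le> L c) + of_bool (\<exists>c\<in>Q. L c \<le> a)
    - of_bool (\<exists>c\<in>Q. L c = a)"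
proof (cases "(\<exists>c\<in>Q. a \<le> L c) \<and> (\<exists>c\<in>Q. L c \<le> a)")
  case True
  then obtain c d where cd: "c \<in> Q" "a \<le> L c" "d \<in> Q" "L d \<le> a" by blast
  have "\<exists>e\<in>Q. L e = a"
  proof (cases "L c = L d")
    case True
    then show ?thesis using cd by (intro bexI[of _ c]) auto
  next
    case False
    define u where "u = (L c - a) / (L c - L d)"
    have u: "0 \<le> u" "u \<le> 1" using cd False by (auto simp: u_def divide_simps)
    have "u * (L c - L d) = L c - a" using False by (simp add: u_def)
    then have "L (\<lambda>i. (1 - u) * c i + u * d i) = a"
      unfolding fun_affineD[OF assms(2)] by (simp add: algebra_simps)
    then show ?thesis using fun_convexD[OF assms(1) cd(1,3) u] by blast
  qed
  then show ?thesis using True cd by auto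
next
  case False
  have "(\<exists>c. c \<in> Q) \<longleftrightarrow> (\<exists>c\<in>Q. a \<le> L c) \<or> (\<exists>c\<in>Q. L c \<le> a)"
    using linear by blast
  moreover have "\<not> (\<exists>c\<in>Q. L c = a)"
    using False by auto
  ultimately show ?thesis using False by simp blast
qed

text \<open>For each \<open>I\<close> the part of \<open>Q\<close> with \<open>c i \<ge> 1\<close>
  on \<open>I\<close> is convex, so \<open>nonempty_split\<close> applies term by term.\<close>

lemma nerve_sum_split:
  assumes "fun_convex Q" "fun_affine L"
  shows "nerve_sum W Q = nerve_sum W {c\<in>Q. a \<le> L c} + nerve_sum W {c\<in>Q. L c \<le> a}
    - nerve_sum W {c\<in>Q. L c = a}"
proof -
  have "fun_convex {c\<in>Q. \<forall>i\<in>I. 1 \<le> c i}" for I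
    using assms(1) by (auto simp: fun_convex_def affine_comb_ge)
  note split = nonempty_split[OF this assms(2)]
  have "(-1) ^ card I * of_bool (\<exists>c\<in>Q. \<forall>i\<in>I. 1 \<le> c i) =
      (-1) ^ card I * of_bool (\<exists>c\<in>{c\<in>Q. a \<le> L c}. \<forall>i\<in>I. 1 \<le> c i)
      + (-1) ^ card I * of_bool (\<exists>c\<in>{c\<in>Q. L c \<le> a}. \<forall>i\<in>I. 1 \<le> c i)
      - (-1) ^ card I * (of_bool (\<exists>c\<in>{c\<in>Q. L c = a}. \<forall>i\<in>I. 1 \<le> c i) :: rat)" for I
    using split[of I a]
    by (simp add: Bex_def conj_ac flip: distrib_left right_diff_distrib)
  then show ?thesis
    unfolding nerve_sum_def sum.distrib[symmetric] sum_subtractf[symmetric]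
    by (intro sum.cong refl)
qed

text \<open>The subsets containing \<open>j\<close> have one more element, so they contribute the
  sum for the \<open>j\<close>-th half-space of \<open>Q\<close> with the opposite sign.\<close>

lemma nerve_sum_insert:
  assumes "finite W" "j \<notin> W"
  shows "nerve_sum (insert j W) Q = nerve_sum W Q - nerve_sum W {c\<in>Q. 1 \<le> c j}"
proof -
  let ?f = "\<lambda>I. (-1) ^ card I * of_bool (\<exists>c\<in>Q. \<forall>i\<in>I. 1 \<le> c i) :: rat"
  have inj: "inj_on (insert j) (Pow W)"
    using assms(2) by (auto simp: inj_on_def)
  have "nerve_sum (insert j W) Q = sum ?f (Pow W) + sum ?f (insert j ` Pow W)"
    unfolding nerve_sum_def Pow_insert
    using assms by (intro sum.union_disjoint) auto
  also have "sum ?f (insert j ` Pow W) = (\<Sum>I\<in>Pow W. ?f (insert j I))"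
    using inj by (simp add: sum.reindex)
  also have "\<dots> = (\<Sum>I\<in>Pow W. - ((-1) ^ card I * of_bool (\<exists>c\<in>{c\<in>Q. 1 \<le> c j}. \<forall>i\<in>I. 1 \<le> c i)))"
  proof (rule sum.cong)
    fix I assume "I \<in> Pow W"
    then have "finite I" "j \<notin> I" using assms finite_subset by auto
    then show "?f (insert j I) = - ((-1) ^ card I * of_bool (\<exists>c\<in>{c\<in>Q. 1 \<le> c j}. \<forall>i\<in>I. 1 \<le> c i))"
      by (simp add: Bex_def conj_ac)
  qed simp
  finally show ?thesis by (simp add: nerve_sum_def sum_negf)
qed

lemma nerve_sum_cover:
  assumes "finite W" "fun_convex Q" "\<And>c. c \<in> Q \<Longrightarrow> \<exists>i\<in>W. 1 \<le> c i"
  shows "nerve_sum W Q = 0"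
  using assms
proof (induction W arbitrary: Q rule: finite_induct)
  case empty
  then have "Q = {}" by blast
  then show ?case by (simp add: nerve_sum_def)
next
  case (insert j W)
  txt \<open>
    Cutting \<open>Q\<close> along the hyperplane \<open>c j = 1\<close> cancels the sets on which the \<open>j\<close>-th condition holds.
    The part with \<open>c j \<le> 1\<close> and the hyperplane itself are covered by the other half-spaces, because
    these are closed and cover the part with \<open>c j < 1\<close>.
  \<close>
  note aff = fun_affine_apply[of j]
  have split: "nerve_sum (insert j W) Q
      = nerve_sum W {c\<in>Q. c j \<le> 1} - nerve_sum W {c\<in>Q. c j = 1}"
    using nerve_sum_insert[OF insert.hyps, of Q] nerve_sum_split[OF insert.prems(1) aff, of W 1]
    by simp
  show ?case
  proof (cases "\<exists>d\<in>Q. d j < 1")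
    case False
    then have "{c\<in>Q. c j \<le> 1} = {c\<in>Q. c j = 1}" by force
    then show ?thesis using split by simp
  next
    case True
    then obtain d where d: "d \<in> Q" "d j < 1" by blast
    have cov: "\<exists>i\<in>W. 1 \<le> c i" if c: "c \<in> Q" "c j \<le> 1" for c
    proof (rule ccontr)
      assume "\<not> ?thesis"
      then have lt: "c i < 1" if "i \<in> W" for i using that by force
      \<comment> \<open>A short move from \<open>c\<close> towards \<open>d\<close> makes coordinate
        \<open>j\<close> strictly less than 1 and keeps the finitely many others below 1, which
        gives an uncovered point of \<open>Q\<close>.\<close>
      let ?e = "\<lambda>u i. (1 - u) * c i + u * d i"
      have ev: "\<forall>\<^sub>F u in at_right 0. \<forall>i\<in>W. ?e u i < 1"
        unfolding eventually_ball_finite_distrib[OF insert.hyps(1)]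
      proof
        fix i assume "i \<in> W"
        have "((\<lambda>u. ?e u i) \<longlongrightarrow> (1 - 0) * c i + 0 * d i) (at_right 0)"
          by (intro tendsto_intros)
        then show "\<forall>\<^sub>F u in at_right 0. ?e u i < 1"
          using lt[OF \<open>i \<in> W\<close>] by (auto dest: order_tendstoD(2))
      qed
      have "\<forall>\<^sub>F u::real in at_right 0. 0 < u \<and> u < 1"
        using eventually_at_right_real[of 0 1] by (simp add: eventually_mono)
      then have "\<forall>\<^sub>F u in at_right 0. (\<forall>i\<in>W. ?e u i < 1) \<and> 0 < u \<and> u < 1"
        using ev eventually_conj by blast
      then obtain u where u: "\<forall>i\<in>W. ?e u i < 1" "0 < u" "u < 1"
        using eventually_happens'[OF trivial_limit_at_right_real] by blast
      have "?e u \<in> Q"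
        using fun_convexD[OF insert.prems(1) c(1) d(1)] u by simp
      moreover have "?e u j < 1"
      proof -
        have "(1 - u) * c j \<le> (1 - u) * 1" "u * d j < u * 1"
          using c d u by (intro mult_left_mono mult_strict_left_mono; simp)+
        then show ?thesis by simp
      qed
      ultimately show False using insert.prems(2)[of "?e u"] u(1) by force
    qed
    have "nerve_sum W {c\<in>Q. c j \<le> 1} = 0" "nerve_sum W {c\<in>Q. c j = 1} = 0"
      using cov by (intro insert.IH fun_convex_restrict[OF insert.prems(1) aff]; auto)+
    then show ?thesis using split by simp
  qed
qed

text \<open>All representations of \<open>x\<close> as a nonnegative combination of the generators
  \<open>u w\<close>; the set is nonempty exactly when \<open>x\<close> lies in the cone they span.
  Values outside \<open>W\<close> are unconstrained.\<close>

definition weights :: "'b set \<Rightarrow> ('b \<Rightarrow> 'a::real_vector) \<Rightarrow> 'a \<Rightarrow> ('b \<Rightarrow> real) set" where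
  "weights W u x = {c. (\<forall>w\<in>W. 0 \<le> c w) \<and> (\<Sum>w\<in>W. c w *\<^sub>R u w) = x}"

lemma fun_convex_weights: "fun_convex (weights W u x)"
proof -
  have "(\<Sum>w\<in>W. ((1 - s) * c w + s * d w) *\<^sub>R u w)
      = (1 - s) *\<^sub>R (\<Sum>w\<in>W. c w *\<^sub>R u w) + s *\<^sub>R (\<Sum>w\<in>W. d w *\<^sub>R u w)" for s :: real and c d
    by (simp add: scaleR_left_distrib sum.distrib scaleR_right.sum)
  then show ?thesis
    by (auto simp: fun_convex_def weights_def affine_comb_ge simp flip: scaleR_left_distrib)
qed

text \<open>Subtracting the indicator of \<open>I\<close> turns the representations of
  \<open>x\<close> with coefficients at least 1 on \<open>I\<close> into those of
  \<open>x - sum u I\<close> and lowers the total by \<open>card I\<close>. The predicate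
  \<open>T\<close> will be trivial for the full cone and an upper bound for its truncation.\<close>

lemma weights_shift:
  assumes "finite W" "I \<subseteq> W"
  shows "(\<exists>c\<in>weights W u x. (\<forall>i\<in>I. 1 \<le> c i) \<and> T (sum c W)) \<longleftrightarrow>
    (\<exists>c\<in>weights W u (x - sum u I). T (sum c W + card I))"
proof -
  have vec: "(\<Sum>w\<in>W. of_bool (w \<in> I) *\<^sub>R u w) = sum u I"
    using assms by (simp add: of_bool_def if_distrib[of "\<lambda>s. s *\<^sub>R _"] Int_absorb1
        flip: sum.inter_restrict cong: if_cong)
  have num: "(\<Sum>w\<in>W. of_bool (w \<in> I)) = real (card I)"
    using assms by (simp add: Int_absorb1)
  show ?thesis
  proof
    assume "\<exists>c\<in>weights W u x. (\<forall>i\<in>I. 1 \<le> c i) \<and> T (sum c W)"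
    then obtain c where c: "c \<in> weights W u x" "\<forall>i\<in>I. 1 \<le> c i" "T (sum c W)" by blast
    let ?d = "\<lambda>w. c w - of_bool (w \<in> I)"
    have "?d \<in> weights W u (x - sum u I)"
      using c vec by (auto simp: weights_def scaleR_left_diff_distrib sum_subtractf)
    moreover have eq: "sum ?d W + card I = sum c W"
      using num by (simp add: sum_subtractf)
    have "T (sum ?d W + card I)"
      unfolding eq by (rule c(3))
    ultimately show "\<exists>c\<in>weights W u (x - sum u I). T (sum c W + card I)"
      by (intro bexI[of _ ?d])
  next
    assume "\<exists>c\<in>weights W u (x - sum u I). T (sum c W + card I)"
    then obtain c where c: "c \<in> weights W u (x - sum u I)" "T (sum c W + card I)" by blast
    let ?d = "\<lambda>w. c w + of_bool (w \<in> I)"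
    have "?d \<in> weights W u x"
      using c vec by (auto simp: weights_def scaleR_left_distrib sum.distrib)
    moreover have eq: "sum ?d W = sum c W + card I"
      using num by (simp add: sum.distrib)
    have "T (sum ?d W)"
      unfolding eq by (rule c(2))
    moreover have "\<forall>i\<in>I. 1 \<le> ?d i"
      using c assms by (auto simp: weights_def)
    ultimately show "\<exists>c\<in>weights W u x. (\<forall>i\<in>I. 1 \<le> c i) \<and> T (sum c W)"
      by (intro bexI[of _ ?d] conjI)
  qed
qed

lemma alternating_sum_eq_nerve_sum:
  assumes "finite W"
  shows "(\<Sum>I\<in>Pow W. (-1) ^ card I * of_bool (\<exists>c\<in>weights W u (x - sum u I). T (sum c W + card I)))
    = nerve_sum W {c\<in>weights W u x. T (sum c W)}"
  unfolding nerve_sum_def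
  using weights_shift[OF assms, of _ u x T]
  by (intro sum.cong refl) (auto simp: Bex_def conj_ac)

text \<open>If every representation had a coefficient at least 1, the half-spaces would cover and
  the sum would vanish. This confines the support of the cone series after multiplication by its
  denominator.\<close>

lemma alternating_sum_weights_nonzero:
  assumes "finite W"
    and "(\<Sum>I\<in>Pow W. (-1) ^ card I * of_bool (weights W u (x - sum u I) \<noteq> {})) \<noteq> (0::rat)"
  shows "\<exists>c\<in>weights W u x. \<forall>w\<in>W. c w < 1"
proof (rule ccontr)
  assume "\<not> ?thesis"
  then have "\<exists>i\<in>W. 1 \<le> c i" if "c \<in> weights W u x" for c
    using that by force
  then have "nerve_sum W (weights W u x) = 0"
    by (intro nerve_sum_cover assms(1) fun_convex_weights)
  then show False
    using assms alternating_sum_eq_nerve_sum[OF assms(1), of u x "\<lambda>_. True"]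
    by (simp add: ex_in_conv)
qed

text \<open>A total of at least \<open>card W\<close> forces some coefficient to be at least 1, so
  the part beyond the cutting hyperplane and the hyperplane itself are covered and contribute
  nothing.\<close>

lemma alternating_sum_weights_truncate:
  assumes "finite W" "real (card W) \<le> N"
  shows "(\<Sum>I\<in>Pow W. (-1) ^ card I * of_bool (weights W u (x - sum u I) \<noteq> {})) =
    (\<Sum>I\<in>Pow W. (-1) ^ card I *
      of_bool (\<exists>c\<in>weights W u (x - sum u I). sum c W + card I \<le> N) :: rat)"
proof -
  let ?Q = "weights W u x" and ?L = "\<lambda>c. \<Sum>w\<in>W. c w"
  have "nerve_sum W {c\<in>?Q. N \<le> ?L c} = nerve_sum W {c\<in>?Q. ?L c = N}"
  proof (cases "W = {}")
    \<comment> \<open>Without generators the total is 0, and \<open>0 \<le> N\<close> makes the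
      conditions \<open>N \<le> 0\<close> and \<open>0 = N\<close> agree.\<close>
    case True
    then show ?thesis using assms(2) by (auto intro!: arg_cong[where f = "nerve_sum {}"])
  next
    case False
    have cov: "\<exists>i\<in>W. 1 \<le> c i" if "N \<le> ?L c" for c
    proof (rule ccontr)
      assume "\<not> ?thesis"
      then have "?L c < (\<Sum>w\<in>W. 1)"
        using assms(1) False by (intro sum_strict_mono) auto
      then show False using that assms(2) by simp
    qed
    show ?thesis
      using nerve_sum_cover[OF assms(1) fun_convex_restrict(1)[OF
            fun_convex_weights[of W u x] fun_affine_sum[of W]], of N]
        nerve_sum_cover[OF assms(1) fun_convex_restrict(3)[OF
            fun_convex_weights[of W u x] fun_affine_sum[of W]], of N]
        cov by simp
  qed
  then have "nerve_sum W ?Q = nerve_sum W {c\<in>?Q. ?L c \<le> N}"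
    using nerve_sum_split[OF fun_convex_weights[of W u x] fun_affine_sum[of W], of W N] by simp
  then show ?thesis
    using alternating_sum_eq_nerve_sum[OF assms(1), of u x "\<lambda>s. s \<le> N"]
      alternating_sum_eq_nerve_sum[OF assms(1), of u x "\<lambda>_. True"]
    by (simp add: ex_in_conv)
qed

subsection \<open>The cone at a vertex is generated by its edges\<close>

lemma weights_mono:
  assumes "finite W" "E \<subseteq> W" "weights E u x \<noteq> {}"
  shows "weights W u x \<noteq> {}"
proof -
  obtain c where c: "c \<in> weights E u x" using assms(3) by blast
  have "(\<Sum>w\<in>W. (if w \<in> E then c w else 0) *\<^sub>R u w) = (\<Sum>w\<in>E. c w *\<^sub>R u w)"
    using assms(1,2)
    by (simp add: if_distrib[of "\<lambda>s. s *\<^sub>R _"] Int_absorb1 flip: sum.inter_restrict cong: if_cong)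
  then have "(\<lambda>w. if w \<in> E then c w else 0) \<in> weights W u x"
    using c by (auto simp: weights_def)
  then show ?thesis by blast
qed

lemma weights_remove_generator:
  assumes "finite E" "e \<in> E" "weights (E - {e}) u (u e) \<noteq> {}" "weights E u x \<noteq> {}"
  shows "weights (E - {e}) u x \<noteq> {}"
proof -
  obtain c d where c: "c \<in> weights E u x" and d: "d \<in> weights (E - {e}) u (u e)"
    using assms(3,4) by blast
  have "(\<Sum>w\<in>E - {e}. (c w + c e * d w) *\<^sub>R u w)
      = (\<Sum>w\<in>E - {e}. c w *\<^sub>R u w) + c e *\<^sub>R (\<Sum>w\<in>E - {e}. d w *\<^sub>R u w)"
    by (simp add: scaleR_left_distrib sum.distrib scaleR_right.sum)
  also have "\<dots> = x"
    using c d assms(1,2) by (simp add: weights_def sum.remove add.commute)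
  finally have "(\<lambda>w. c w + c e * d w) \<in> weights (E - {e}) u x"
    using c d assms(2) by (auto simp: weights_def)
  then show ?thesis by blast
qed

lemma vertex_cone_conv_weights:
  assumes "finite {w. adjacent_vertices P v w}"
  shows "x \<in> vertex_cone P v \<longleftrightarrow> weights {w. adjacent_vertices P v w} (\<lambda>w. w - v) x \<noteq> {}"
proof
  assume "x \<in> vertex_cone P v"
  then show "weights {w. adjacent_vertices P v w} (\<lambda>w. w - v) x \<noteq> {}"
    by (auto simp: vertex_cone_def weights_def)
next
  let ?A = "{w. adjacent_vertices P v w}"
  assume "weights ?A (\<lambda>w. w - v) x \<noteq> {}"
  then obtain c where c: "c \<in> weights ?A (\<lambda>w. w - v) x" by blast
  \<comment> \<open>\<open>vertex_cone\<close> asks for nonnegative coefficients everywhere,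
    \<open>weights\<close> only on the neighbours.\<close>
  let ?d = "\<lambda>w. max 0 (c w)"
  have "(\<Sum>w\<in>?A. ?d w *\<^sub>R (w - v)) = (\<Sum>w\<in>?A. c w *\<^sub>R (w - v))"
    using c by (intro sum.cong) (auto simp: weights_def)
  then have "x = (\<Sum>w\<in>?A. ?d w *\<^sub>R (w - v))"
    using c by (simp add: weights_def)
  then show "x \<in> vertex_cone P v"
    unfolding vertex_cone_def by (intro CollectI exI[of _ ?d]) simp
qed

text \<open>A nontrivial relation, divided by its total, would exhibit \<open>v\<close> as a convex
  combination of points of \<open>P - {v}\<close>, which is convex because \<open>v\<close> is
  extreme.\<close>

lemma pointed_at_extreme_point:
  assumes "convex P" "v extreme_point_of P" "finite E" "E \<subseteq> P - {v}"
    and "\<forall>w\<in>E. 0 \<le> c w" "(\<Sum>w\<in>E. c w *\<^sub>R (w - v)) = 0" "e \<in> E"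
  shows "c e = 0"
proof (rule ccontr)
  assume "c e \<noteq> 0"
  define s where "s = sum c E"
  have "s \<noteq> 0"
    using assms \<open>c e \<noteq> 0\<close> by (auto simp: s_def sum_nonneg_eq_0_iff)
  have "s *\<^sub>R v = (\<Sum>w\<in>E. c w *\<^sub>R w)"
    using assms(6) by (simp add: s_def scaleR_right_diff_distrib sum_subtractf scaleR_left.sum)
  then have "(\<Sum>w\<in>E. (c w / s) *\<^sub>R w) = (1 / s) *\<^sub>R (s *\<^sub>R v)"
    by (simp add: scaleR_right.sum)
  also have "\<dots> = v" using \<open>s \<noteq> 0\<close> by simp
  finally have v: "(\<Sum>w\<in>E. (c w / s) *\<^sub>R w) = v" .
  have "convex (P - {v})" using assms(1,2) extreme_point_of_stillconvex by blast
  moreover have "0 \<le> s" unfolding s_def using assms(5) by (intro sum_nonneg) auto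
  moreover have "(\<Sum>w\<in>E. c w / s) = 1"
    using \<open>s \<noteq> 0\<close> by (simp add: s_def flip: sum_divide_distrib)
  ultimately have "(\<Sum>w\<in>E. (c w / s) *\<^sub>R w) \<in> P - {v}"
    using assms by (intro convex_sum) auto
  then show False using v by simp
qed

lemma convex_hull_minus_vertex_weights:
  assumes "finite V" "v \<in> V" "a \<in> convex hull V"
  shows "weights (V - {v}) (\<lambda>w. w - v) (a - v) \<noteq> {}"
proof -
  obtain c where c: "\<forall>w\<in>V. 0 \<le> c w" "sum c V = 1" "(\<Sum>w\<in>V. c w *\<^sub>R w) = a"
    using assms(3) convex_hull_finite[OF assms(1)] by auto
  have "(\<Sum>w\<in>V - {v}. c w *\<^sub>R (w - v)) = (\<Sum>w\<in>V. c w *\<^sub>R (w - v))"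
    using assms(1,2) by (simp add: sum.remove)
  also have "\<dots> = a - v"
    using c by (simp add: scaleR_right_diff_distrib sum_subtractf flip: scaleR_left.sum)
  finally have "c \<in> weights (V - {v}) (\<lambda>w. w - v) (a - v)"
    using c by (auto simp: weights_def)
  then show ?thesis by blast
qed

text \<open>Let an open segment with ends \<open>a\<close>, \<open>b\<close> in \<open>P\<close>
  meet the segment from \<open>v\<close> to \<open>e\<close>. Mixing representations of
  \<open>a - v\<close> and \<open>b - v\<close> represents a multiple of \<open>e - v\<close>;
  irredundancy of \<open>e\<close> and pointedness at \<open>v\<close> then leave no generator but
  \<open>e\<close>.\<close>

lemma minimal_generator_edge:
  fixes v :: "'a::euclidean_space"
  assumes P: "P = convex hull V" "finite V" "\<And>w. w \<in> V \<Longrightarrow> w extreme_point_of P"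
    and v: "v \<in> V" and E: "E \<subseteq> V - {v}" "e \<in> E"
    and gen: "\<And>a. a \<in> P \<Longrightarrow> weights E (\<lambda>w. w - v) (a - v) \<noteq> {}"
    and minimal: "weights (E - {e}) (\<lambda>w. w - v) (e - v) = {}"
  shows "closed_segment v e edge_of P"
proof -
  have finE: "finite E" using P(2) E(1) finite_subset by blast
  have convP: "convex P" by (simp add: P(1))
  have VP: "V \<subseteq> P" by (simp add: P(1) hull_subset)
  have ve: "v \<in> P" "e \<in> P" "e \<noteq> v" using VP v E by auto
  have ray: "a \<in> closed_segment v e"
    if a: "a \<in> P" and c: "c \<in> weights E (\<lambda>w. w - v) (a - v)" and z: "\<forall>w\<in>E - {e}. c w = 0" for a c
  proof -
    have "a - v = (\<Sum>w\<in>E. c w *\<^sub>R (w - v))" using c by (simp add: weights_def)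
    also have "\<dots> = c e *\<^sub>R (e - v)" using z finE E(2) by (simp add: sum.remove)
    finally have av: "a = v + c e *\<^sub>R (e - v)" by (simp add: algebra_simps)
    have "0 \<le> c e" using c E(2) by (simp add: weights_def)
    \<comment> \<open>A coefficient above 1 would put \<open>e\<close> strictly between
      \<open>v\<close> and \<open>a\<close>, against its extremality.\<close>
    moreover have "c e \<le> 1"
    proof (rule ccontr)
      assume "\<not> c e \<le> 1"
      moreover have "(1 - 1 / c e) *\<^sub>R v + (1 / c e) *\<^sub>R a = v + ((1 / c e) * c e) *\<^sub>R (e - v)"
        by (simp add: av algebra_simps)
      ultimately have "a \<noteq> v" "e = (1 - 1 / c e) *\<^sub>R v + (1 / c e) *\<^sub>R a" "0 < 1 / c e" "1 / c e < 1"
        using ve(3) by (auto simp: av)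
      then have "e \<in> open_segment v a" unfolding in_segment by blast
      then show False
        using P(3)[of e] E a ve(1) by (auto simp: extreme_point_of_def)
    qed
    ultimately show ?thesis
      unfolding in_segment by (intro exI[of _ "c e"]) (simp add: av algebra_simps)
  qed
  have face: "a \<in> closed_segment v e \<and> b \<in> closed_segment v e"
    if a: "a \<in> P" and b: "b \<in> P" and p: "p \<in> closed_segment v e" "p \<in> open_segment a b" for a b p
  proof -
    obtain c d where c: "c \<in> weights E (\<lambda>w. w - v) (a - v)" and d: "d \<in> weights E (\<lambda>w. w - v) (b - v)"
      using gen a b by blast
    obtain r where r: "0 < r" "r < 1" "p = (1 - r) *\<^sub>R a + r *\<^sub>R b"
      using p(2) by (auto simp: in_segment)
    obtain s where s: "0 \<le> s" "p = (1 - s) *\<^sub>R v + s *\<^sub>R e"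
      using p(1) by (auto simp: in_segment)
    define g where "g w = (1 - r) * c w + r * d w" for w
    have gnn: "0 \<le> g w" if "w \<in> E" for w
      using c d r that by (simp add: g_def weights_def)
    have "(\<Sum>w\<in>E. g w *\<^sub>R (w - v)) = (1 - r) *\<^sub>R (\<Sum>w\<in>E. c w *\<^sub>R (w - v)) + r *\<^sub>R (\<Sum>w\<in>E. d w *\<^sub>R (w - v))"
      by (simp add: g_def scaleR_left_distrib sum.distrib scaleR_right.sum)
    also have "\<dots> = (1 - r) *\<^sub>R (a - v) + r *\<^sub>R (b - v)"
      using c d by (simp add: weights_def)
    also have "\<dots> = p - v" using r(3) by (simp add: algebra_simps)
    also have "\<dots> = s *\<^sub>R (e - v)" using s(2) by (simp add: algebra_simps)
    finally have "g e *\<^sub>R (e - v) + (\<Sum>w\<in>E - {e}. g w *\<^sub>R (w - v)) = s *\<^sub>R (e - v)"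
      using finE E(2) by (simp add: sum.remove)
    then have sum: "(\<Sum>w\<in>E - {e}. g w *\<^sub>R (w - v)) = (s - g e) *\<^sub>R (e - v)"
      by (simp add: algebra_simps)
    have "s \<le> g e"
    \<comment> \<open>Otherwise division by \<open>s - g e\<close> would represent
      \<open>e - v\<close> by the remaining generators.\<close>
    proof (rule ccontr)
      assume *: "\<not> s \<le> g e"
      have "(\<Sum>w\<in>E - {e}. (g w / (s - g e)) *\<^sub>R (w - v))
          = (1 / (s - g e)) *\<^sub>R (\<Sum>w\<in>E - {e}. g w *\<^sub>R (w - v))"
        by (simp add: scaleR_right.sum)
      also have "\<dots> = e - v" using sum * by simp
      finally have "(\<lambda>w. g w / (s - g e)) \<in> weights (E - {e}) (\<lambda>w. w - v) (e - v)"
        using * gnn by (simp add: weights_def)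
      then show False using minimal by blast
    qed
    \<comment> \<open>Moving \<open>s *\<^sub>R (e - v)\<close> to the other side leaves a
      nonnegative relation, so all its coefficients vanish.\<close>
    define h where "h w = (if w = e then g e - s else g w)" for w
    have "(\<Sum>w\<in>E. h w *\<^sub>R (w - v)) = (g e - s) *\<^sub>R (e - v) + (\<Sum>w\<in>E - {e}. g w *\<^sub>R (w - v))"
      using finE E(2) by (simp add: sum.remove h_def)
    also have "\<dots> = 0" unfolding sum by (simp add: algebra_simps)
    finally have h0: "h w = 0" if "w \<in> E" for w
      using \<open>s \<le> g e\<close> gnn E(1) VP that
      by (intro pointed_at_extreme_point[OF convP P(3)[OF v] finE]) (auto simp: h_def)
    have g0: "g w = 0" if "w \<in> E - {e}" for w
      using h0[of w] that by (auto simp: h_def)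
    have "c w = 0 \<and> d w = 0" if w: "w \<in> E - {e}" for w
    proof -
      have "0 \<le> c w" "0 \<le> d w" using c d w by (auto simp: weights_def)
      then have "0 \<le> (1 - r) * c w" "0 \<le> r * d w" using r by auto
      then have "(1 - r) * c w = 0" "r * d w = 0" using g0[OF w] unfolding g_def by linarith+
      then show ?thesis using r by simp
    qed
    then show ?thesis using ray[OF a c] ray[OF b d] by blast
  qed
  have "closed_segment v e face_of P"
    unfolding face_of_def
  proof (intro conjI ballI impI)
    show "closed_segment v e \<subseteq> P" using ve convP by (simp add: closed_segment_subset)
  next
    fix a b p
    assume "a \<in> P" "b \<in> P" "p \<in> closed_segment v e" "p \<in> open_segment a b"
    from face[OF this] show "a \<in> closed_segment v e" "b \<in> closed_segment v e" by simp_all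
  qed simp
  moreover have "aff_dim (closed_segment v e) = 1"
    using ve(3) by (simp add: segment_convex_hull aff_dim_convex_hull aff_dim_2)
  ultimately show ?thesis by (simp add: edge_of_def)
qed

text \<open>Among the finitely many sets of directions that generate the full cone at
  \<open>v\<close>, a minimal one contains only irredundant directions, and these are edges.\<close>

lemma adjacent_vertices_generate:
  assumes P: "convex hull vertices P = P" "finite (vertices P)"
    and v: "v \<in> vertices P"
  shows "x \<in> vertex_cone P v \<longleftrightarrow> weights (vertices P - {v}) (\<lambda>w. w - v) x \<noteq> {}"
proof -
  let ?V = "vertices P - {v}" and ?A = "{w. adjacent_vertices P v w}" and ?u = "\<lambda>w. w - v"
  define gen where "gen E \<longleftrightarrow> (\<forall>x. weights ?V ?u x \<noteq> {} \<longrightarrow> weights E ?u x \<noteq> {})" for E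
  have adj: "?A \<subseteq> ?V"
    by (auto simp: adjacent_vertices_def edge_of_def)
  have finV: "finite ?V" and finA: "finite ?A"
    using P(2) adj by (auto intro: finite_subset)
  define F where "F = {E \<in> Pow ?V. gen E}"
  have "finite F" "?V \<in> F" using finV by (simp_all add: F_def gen_def)
  from finite_has_minimal2[OF this] obtain E where
    "E \<in> F" and minimal: "\<forall>E'\<in>F. E' \<subseteq> E \<longrightarrow> E = E'" by blast
  then have E: "E \<subseteq> ?V" "gen E" by (simp_all add: F_def)
  have "E \<subseteq> ?A"
  proof
    fix e assume e: "e \<in> E"
    have finE: "finite E" using E(1) finV finite_subset by blast
    have "E - {e} \<notin> F" using minimal[rule_format, of "E - {e}"] e by blast
    then have "\<not> gen (E - {e})" using E(1) by (auto simp: F_def)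
    then obtain y where "weights E ?u y \<noteq> {}" "weights (E - {e}) ?u y = {}"
      using E(2) unfolding gen_def by blast
    then have "weights (E - {e}) ?u (e - v) = {}"
      using weights_remove_generator[OF finE e, of ?u y] by blast
    moreover have "weights E ?u (a - v) \<noteq> {}" if "a \<in> P" for a
      using convex_hull_minus_vertex_weights[OF P(2) v, of a] E(2) that P(1)
      by (simp add: gen_def)
    ultimately have "closed_segment v e edge_of P"
      using minimal_generator_edge[OF P(1)[symmetric] P(2) _ v E(1) e] by (simp add: vertices_def)
    then show "e \<in> ?A" using v e E(1) by (auto simp: adjacent_vertices_def)
  qed
  then have "weights ?A ?u x \<noteq> {}" if "weights ?V ?u x \<noteq> {}"
    using weights_mono[OF finA, of E ?u x] E(2) that by (simp add: gen_def)
  then show ?thesis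
    unfolding vertex_cone_conv_weights[OF finA] using weights_mono[OF finV adj, of ?u x] by argo
qed

subsection \<open>Transforms of cones at lattice points\<close>

lemma exponent_vec_nth: "exponent_vec m $ i = of_int (Poly_Mapping.lookup m i)"
  by (simp add: exponent_vec_def)

lemma exponent_vec_in_lattice_points: "exponent_vec m \<in> lattice_points"
  by (simp add: lattice_points_def exponent_vec_nth)

lemma exponent_vec_diff: "exponent_vec (m - k) = exponent_vec m - exponent_vec k"
  by (simp add: vec_eq_iff exponent_vec_nth lookup_minus)

lemma exponent_vec_add: "exponent_vec (m + k) = exponent_vec m + exponent_vec k"
  by (simp add: vec_eq_iff exponent_vec_nth lookup_add)

lemma inj_exponent_vec: "inj exponent_vec"
  by (rule injI) (auto intro!: poly_mapping_eqI simp: vec_eq_iff exponent_vec_nth)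

text \<open>Inverse to \<open>exponent_vec\<close> on lattice points; the rounding only has an
  effect elsewhere.\<close>

definition exponent :: "real^'n::finite \<Rightarrow> ('n \<Rightarrow>\<^sub>0 int)" where
  "exponent v = Abs_poly_mapping (\<lambda>i. \<lfloor>v $ i\<rfloor>)"

lemma lookup_exponent: "Poly_Mapping.lookup (exponent v) i = \<lfloor>v $ i\<rfloor>"
  by (simp add: exponent_def)

lemma exponent_vec_exponent: "v \<in> lattice_points \<Longrightarrow> exponent_vec (exponent v) = v"
  by (auto simp: vec_eq_iff exponent_vec_nth lookup_exponent lattice_points_def)

lemma exponent_exponent_vec: "exponent (exponent_vec m) = m"
  by (rule poly_mapping_eqI) (simp add: lookup_exponent exponent_vec_nth)

lemma lattice_points_add: "v \<in> lattice_points \<Longrightarrow> w \<in> lattice_points \<Longrightarrow> v + w \<in> lattice_points"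
  by (simp add: lattice_points_def)

lemma lattice_points_sum: "W \<subseteq> lattice_points \<Longrightarrow> \<Sum>W \<in> lattice_points"
  by (auto simp: lattice_points_def intro!: Ints_sum)

lemma lattice_points_scaleR_nat: "v \<in> lattice_points \<Longrightarrow> real k *\<^sub>R v \<in> lattice_points"
  by (simp add: lattice_points_def)

lemma exponent_add:
  "v \<in> lattice_points \<Longrightarrow> w \<in> lattice_points \<Longrightarrow> exponent (v + w) = exponent v + exponent w"
  by (intro injD[OF inj_exponent_vec])
    (simp add: exponent_vec_exponent exponent_vec_add lattice_points_add)

section \<open>Monomials of lattice points\<close>

definition lmonom :: "real^'n::finite \<Rightarrow> 'n laurent_poly" where
  "lmonom v = Poly_Mapping.single (exponent v) 1"

lemma lmonom_0: "lmonom (0 :: real^'n::finite) = 1"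
proof -
  have "exponent (0 :: real^'n) = 0" by (rule poly_mapping_eqI) (simp add: lookup_exponent)
  then show ?thesis by (simp add: lmonom_def)
qed

lemma lmonom_add:
  "v \<in> lattice_points \<Longrightarrow> w \<in> lattice_points \<Longrightarrow> lmonom (v + w) = lmonom v * lmonom w"
  by (simp add: lmonom_def exponent_add mult_single)

lemma lmonom_power:
  assumes "v \<in> lattice_points"
  shows "lmonom v ^ k = lmonom (real k *\<^sub>R v)"
proof (induction k)
  case (Suc k)
  then show ?case
    using lmonom_add[OF assms lattice_points_scaleR_nat[OF assms, of k]]
    by (simp add: scaleR_left_distrib)
qed (simp add: lmonom_0)

lemma lmonom_sum:
  assumes "finite W" "W \<subseteq> lattice_points"
  shows "prod lmonom W = lmonom (\<Sum>W)"
  using assms by (induction W) (simp_all add: lmonom_0 lmonom_add lattice_points_sum)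

lemma lmonom_eq_iff:
  "v \<in> lattice_points \<Longrightarrow> w \<in> lattice_points \<Longrightarrow> lmonom v = lmonom w \<longleftrightarrow> v = w"
  using exponent_vec_exponent by (metis lmonom_def inj_single injD keys_single
      singleton_inject zero_neq_one)

lemma lookup_lmonom_mult:
  "Poly_Mapping.lookup (lmonom v * f) m = Poly_Mapping.lookup f (m - exponent v)"
  by (simp add: lmonom_def series_mult_single flip: series_mult_lookup)

section \<open>Binomial products acting on series of point sets\<close>

lemma point_series_shift:
  "v \<in> lattice_points \<Longrightarrow> point_series S (m - exponent v) = of_bool (exponent_vec m - v \<in> S)"
  by (simp add: point_series_def exponent_vec_diff exponent_vec_exponent)

lemma series_mult_sum: "series_mult (sum f A) s m = (\<Sum>a\<in>A. series_mult (f a) s m)"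
proof (induction A rule: infinite_finite_induct)
  case (insert a A)
  then show ?case by (simp add: series_mult_add)
qed (simp_all add: series_mult_def)

text \<open>Expanding the product, the subset \<open>I\<close> records the factors from which
  \<open>lmonom w\<close> is taken. Its exponent \<open>b I\<close> equals
  \<open>(t + card W) v\<close> plus the sum of \<open>w - v\<close> over \<open>I\<close>, so the
  shifts are by sums of cone generators.\<close>

lemma series_mult_prod_diff:
  assumes W: "finite W" "W \<subseteq> lattice_points" and v: "v \<in> lattice_points"
  shows "series_mult (lmonom v ^ t * (\<Prod>w\<in>W. lmonom v - lmonom w)) (point_series S) m =
    (\<Sum>I\<in>Pow W. (-1) ^ card I *
      of_bool (exponent_vec m - real (t + card W) *\<^sub>R v - (\<Sum>w\<in>I. w - v) \<in> S))"
proof -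
  define b where "b I = \<Sum>I + real (t + card W - card I) *\<^sub>R v" for I
  have b: "b I \<in> lattice_points" if "I \<subseteq> W" for I
    unfolding b_def using that W v
    by (intro lattice_points_add lattice_points_sum lattice_points_scaleR_nat) auto
  have "lmonom v ^ t * (\<Prod>w\<in>W. lmonom v - lmonom w)
      = (\<Sum>I\<in>Pow W. lmonom v ^ t * ((-1) ^ card I * prod lmonom I * (\<Prod>w\<in>W - I. lmonom v)))"
    by (simp add: prod_diff_conv_sum[OF W(1)] sum_distrib_left)
  also have "\<dots> = (\<Sum>I\<in>Pow W. Poly_Mapping.single (exponent (b I)) ((-1) ^ card I))"
  proof (rule sum.cong)
    fix I assume "I \<in> Pow W"
    then have I: "I \<subseteq> W" "finite I" "card I \<le> card W" "I \<subseteq> lattice_points"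
      using W by (auto intro: finite_subset card_mono)
    have k: "t + card W - card I = t + (card W - card I)"
      using I by simp
    have "lmonom v ^ t * ((-1) ^ card I * prod lmonom I * (\<Prod>w\<in>W - I. lmonom v))
        = (-1) ^ card I * (prod lmonom I * lmonom v ^ (t + (card W - card I)))"
      unfolding power_add using I by (simp add: card_Diff_subset mult_ac)
    also have "prod lmonom I * lmonom v ^ (t + (card W - card I)) = lmonom (b I)"
      unfolding lmonom_sum[OF I(2,4)] lmonom_power[OF v] b_def k
      by (intro lmonom_add[symmetric] lattice_points_sum lattice_points_scaleR_nat I v)
    also have "(-1) ^ card I * lmonom (b I) = Poly_Mapping.single (exponent (b I)) ((-1) ^ card I)"
      by (cases "even (card I)") (simp_all add: lmonom_def single_uminus)
    finally show "lmonom v ^ t * ((-1) ^ card I * prod lmonom I * (\<Prod>w\<in>W - I. lmonom v))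
        = Poly_Mapping.single (exponent (b I)) ((-1) ^ card I)" .
  qed simp
  finally have "series_mult (lmonom v ^ t * (\<Prod>w\<in>W. lmonom v - lmonom w)) (point_series S) m
      = (\<Sum>I\<in>Pow W. (-1) ^ card I * of_bool (exponent_vec m - b I \<in> S))"
    using b by (simp add: series_mult_sum series_mult_single point_series_shift)
  also have "\<dots> = (\<Sum>I\<in>Pow W. (-1) ^ card I *
      of_bool (exponent_vec m - real (t + card W) *\<^sub>R v - (\<Sum>w\<in>I. w - v) \<in> S))"
  proof (rule sum.cong)
    fix I assume "I \<in> Pow W"
    then have I: "card I \<le> card W" using W by (auto intro: card_mono)
    have "exponent_vec m - b I = exponent_vec m - real (t + card W) *\<^sub>R v - (\<Sum>w\<in>I. w - v)"
      using I by (simp add: b_def of_nat_diff sum_subtractf scaleR_diff_left sum_constant_scaleR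
          del: sum_constant)
    then show "(-1) ^ card I * of_bool (exponent_vec m - b I \<in> S) = (-1) ^ card I *
      of_bool (exponent_vec m - real (t + card W) *\<^sub>R v - (\<Sum>w\<in>I. w - v) \<in> S)"
      by (simp only:)
  qed simp
  finally show ?thesis .
qed

lemma finite_bounded_exponents:
  fixes S :: "(real^'n::finite) set"
  assumes "bounded S"
  shows "finite {m. exponent_vec m \<in> S}"
proof -
  obtain B where B: "\<And>x. x \<in> S \<Longrightarrow> norm x \<le> B"
    using assms unfolding bounded_iff by blast
  have "Poly_Mapping.lookup ` {m. exponent_vec m \<in> S} \<subseteq> (UNIV :: 'n set) \<rightarrow>\<^sub>E {-\<lceil>B\<rceil>..\<lceil>B\<rceil>}"
  proof (clarsimp simp: PiE_iff)
    fix m :: "'n \<Rightarrow>\<^sub>0 int" and i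
    assume "exponent_vec m \<in> S"
    then have "\<bar>real_of_int (Poly_Mapping.lookup m i)\<bar> \<le> B"
      using B component_le_norm_cart[of "exponent_vec m" i]
      by (fastforce simp: exponent_vec_nth)
    then show "- \<lceil>B\<rceil> \<le> Poly_Mapping.lookup m i \<and> Poly_Mapping.lookup m i \<le> \<lceil>B\<rceil>"
      by linarith
  qed
  then have "finite (Poly_Mapping.lookup ` {m. exponent_vec m \<in> S})"
    by (rule finite_subset) (simp add: finite_PiE)
  then show ?thesis
    by (rule finite_imageD) (simp add: inj_on_def)
qed

text \<open>Meaningful when the series has finite support, which boundedness of \<open>S\<close>
  ensures.\<close>

definition lattice_poly :: "(real^'n::finite) set \<Rightarrow> 'n laurent_poly" where
  "lattice_poly S = Abs_poly_mapping (point_series S)"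

lemma lookup_lattice_poly:
  assumes "bounded S"
  shows "Poly_Mapping.lookup (lattice_poly S) = point_series S"
  using finite_bounded_exponents[OF assms]
  by (simp add: lattice_poly_def point_series_def)

text \<open>A nonzero coefficient requires a representation with all coefficients in
  \<open>[0,1)\<close>. Such points fill at most a translated zonotope, which is bounded, so the
  product has finite support. With the neighbours as \<open>W\<close> this gives the small
  denominator.\<close>

lemma cone_transform_polynomial:
  fixes W :: "(real^'n::finite) set"
  assumes W: "finite W" "W \<subseteq> lattice_points" and v: "v \<in> lattice_points"
  shows "\<exists>f. series_mult (\<Prod>w\<in>W. lmonom v - lmonom w)
    (point_series {x. weights W (\<lambda>w. w - v) x \<noteq> {}}) = Poly_Mapping.lookup f"
proof -
  let ?u = "\<lambda>w. w - v"
  let ?s = "series_mult (\<Prod>w\<in>W. lmonom v - lmonom w) (point_series {x. weights W ?u x \<noteq> {}})"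
  define B where "B = (\<Sum>w\<in>W. norm (w - v)) + real (card W) * norm v"
  have "norm (exponent_vec m) \<le> B" if "?s m \<noteq> 0" for m
  proof -
    let ?y = "exponent_vec m - real (card W) *\<^sub>R v"
    have "?s m = (\<Sum>I\<in>Pow W. (-1) ^ card I * of_bool (weights W ?u (?y - sum ?u I) \<noteq> {}))"
      using series_mult_prod_diff[OF W v, of 0] by simp
    with that have "(\<Sum>I\<in>Pow W. (-1) ^ card I * of_bool (weights W ?u (?y - sum ?u I) \<noteq> {})) \<noteq> (0::rat)"
      by argo
    then obtain c where c: "c \<in> weights W ?u ?y" "\<forall>w\<in>W. c w < 1"
      using alternating_sum_weights_nonzero[OF W(1), of ?u ?y] by blast
    have "exponent_vec m = (\<Sum>w\<in>W. c w *\<^sub>R ?u w) + real (card W) *\<^sub>R v"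
      using c(1) by (simp add: weights_def)
    also have "norm \<dots> \<le> (\<Sum>w\<in>W. norm (c w *\<^sub>R ?u w)) + norm (real (card W) *\<^sub>R v)"
      by (intro norm_triangle_mono norm_sum order_refl)
    also have "(\<Sum>w\<in>W. norm (c w *\<^sub>R ?u w)) \<le> (\<Sum>w\<in>W. norm (?u w))"
    proof (rule sum_mono)
      fix w assume "w \<in> W"
      then have "\<bar>c w\<bar> \<le> 1" using c by (force simp: weights_def)
      then show "norm (c w *\<^sub>R ?u w) \<le> norm (?u w)" by (simp add: mult_left_le_one_le)
    qed
    finally show ?thesis by (simp add: B_def)
  qed
  then have "{m. ?s m \<noteq> 0} \<subseteq> {m. exponent_vec m \<in> cball 0 B}"
    by auto
  then have "finite {m. ?s m \<noteq> 0}"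
    using finite_bounded_exponents[OF bounded_cball] finite_subset by blast
  then have "?s = Poly_Mapping.lookup (Abs_poly_mapping ?s)"
    by simp
  then show ?thesis by blast
qed

text \<open>A point of the \<open>k\<close>-th dilate has barycentric weights of total
  \<open>k\<close>. The weight at \<open>v\<close> multiplies \<open>v - v = 0\<close>, so it only
  appears as slack in the bound.\<close>

lemma mem_dilate_iff_weights:
  assumes "finite V" "v \<in> V"
  shows "z \<in> (*\<^sub>R) (real k) ` (convex hull V) \<longleftrightarrow>
    (\<exists>c\<in>weights (V - {v}) (\<lambda>w. w - v) (z - real k *\<^sub>R v). sum c (V - {v}) \<le> real k)"
    (is "?L \<longleftrightarrow> ?R")
proof
  assume ?L
  then obtain a where a: "\<forall>w\<in>V. 0 \<le> a w" "sum a V = 1" "z = real k *\<^sub>R (\<Sum>w\<in>V. a w *\<^sub>R w)"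
    using convex_hull_finite[OF assms(1)] by auto
  let ?c = "\<lambda>w. real k * a w"
  have "(\<Sum>w\<in>V - {v}. ?c w *\<^sub>R (w - v)) = (\<Sum>w\<in>V. ?c w *\<^sub>R (w - v))"
    using assms by (simp add: sum.remove)
  also have "\<dots> = z - real k *\<^sub>R v"
    using a by (simp add: scaleR_right_diff_distrib sum_subtractf scaleR_right.sum
        flip: scaleR_left.sum sum_distrib_left)
  finally have "?c \<in> weights (V - {v}) (\<lambda>w. w - v) (z - real k *\<^sub>R v)"
    using a by (simp add: weights_def)
  moreover have "sum ?c (V - {v}) \<le> real k"
  proof -
    have "sum a (V - {v}) \<le> 1"
      using a assms by (simp add: sum_diff1)
    then show ?thesis by (simp add: mult_left_le flip: sum_distrib_left)
  qed
  ultimately show ?R by (intro bexI[of _ ?c])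
next
  let ?W = "V - {v}"
  assume ?R
  then obtain c where c: "c \<in> weights ?W (\<lambda>w. w - v) (z - real k *\<^sub>R v)" "sum c ?W \<le> real k"
    by blast
  then have nn: "\<forall>w\<in>?W. 0 \<le> c w" and z: "z = real k *\<^sub>R v + (\<Sum>w\<in>?W. c w *\<^sub>R (w - v))"
    by (auto simp: weights_def algebra_simps)
  show ?L
  proof (cases "k = 0")
    \<comment> \<open>Dividing by \<open>k\<close> is impossible here; the bound forces all
      coefficients to 0, so \<open>z = 0\<close>, and the hull is nonempty since it contains
      \<open>v\<close>.\<close>
    case True
    moreover have "0 \<le> sum c ?W" using nn by (intro sum_nonneg) auto
    ultimately have "sum c ?W = 0" using c(2) by simp
    then have "\<forall>w\<in>?W. c w = 0" using nn assms(1) by (subst (asm) sum_nonneg_eq_0_iff) auto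
    then have "z = 0" using True z by simp
    then show ?thesis
      using True hull_inc[OF assms(2), of convex] by auto
  next
    case False
    \<comment> \<open>The vertex \<open>v\<close> receives the slack, so that the weights sum to
      1.\<close>
    define b where "b w = (if w = v then 1 - sum c ?W / real k else c w / real k)" for w
    have "sum b V = b v + sum b ?W" using assms by (simp add: sum.remove)
    also have "sum b ?W = (\<Sum>w\<in>?W. c w / real k)" by (rule sum.cong) (auto simp: b_def)
    finally have "sum b V = 1" by (simp add: b_def flip: sum_divide_distrib)
    moreover have "\<forall>w\<in>V. 0 \<le> b w" using nn c(2) False by (auto simp: b_def)
    moreover have "real k *\<^sub>R (\<Sum>w\<in>V. b w *\<^sub>R w) = z"
    proof -
      have "real k *\<^sub>R (\<Sum>w\<in>V. b w *\<^sub>R w) = (real k * b v) *\<^sub>R v + (\<Sum>w\<in>?W. (real k * b w) *\<^sub>R w)"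
        using assms by (simp add: sum.remove scaleR_add_right scaleR_right.sum)
      also have "(\<Sum>w\<in>?W. (real k * b w) *\<^sub>R w) = (\<Sum>w\<in>?W. c w *\<^sub>R w)"
        using False by (intro sum.cong) (auto simp: b_def)
      also have "real k * b v = real k - sum c ?W"
        using False by (simp add: b_def algebra_simps)
      also have "(real k - sum c ?W) *\<^sub>R v + (\<Sum>w\<in>?W. c w *\<^sub>R w) = z"
        unfolding z by (simp add: scaleR_right_diff_distrib sum_subtractf scaleR_left_diff_distrib
            flip: scaleR_left.sum)
      finally show ?thesis .
    qed
    ultimately show ?thesis
      unfolding convex_hull_finite[OF assms(1)] by blast
  qed
qed

text \<open>Truncating the totals at \<open>t + card W\<close> leaves the alternating sum unchanged.
  After the shift by \<open>I\<close> the bound is \<open>t + card W - card I\<close>, which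
  describes membership in that dilate of the polytope.\<close>

lemma cone_transform_dilates:
  fixes V :: "(real^'n::finite) set"
  assumes V: "finite V" "V \<subseteq> lattice_points" and v: "v \<in> V"
  defines "W \<equiv> V - {v}"
  shows "series_mult (lmonom v ^ t * (\<Prod>w\<in>W. lmonom v - lmonom w))
      (point_series {x. weights W (\<lambda>w. w - v) x \<noteq> {}}) =
    Poly_Mapping.lookup (\<Sum>I\<in>Pow W. (-1) ^ card I * prod lmonom I *
      lattice_poly ((*\<^sub>R) (real (t + card W - card I)) ` (convex hull V)))"
    (is "_ = Poly_Mapping.lookup (\<Sum>I\<in>_. ?f I)")
proof
  fix m
  let ?u = "\<lambda>w. w - v" and ?y = "exponent_vec m - real (t + card W) *\<^sub>R v"
  have W: "finite W" "W \<subseteq> lattice_points" and vL: "v \<in> lattice_points"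
    using V v by (auto simp: W_def)
  have "series_mult (lmonom v ^ t * (\<Prod>w\<in>W. lmonom v - lmonom w))
      (point_series {x. weights W ?u x \<noteq> {}}) m =
    (\<Sum>I\<in>Pow W. (-1) ^ card I * of_bool (weights W ?u (?y - sum ?u I) \<noteq> {}))"
    using series_mult_prod_diff[OF W vL] by simp
  also have "\<dots> = (\<Sum>I\<in>Pow W. (-1) ^ card I *
      of_bool (\<exists>c\<in>weights W ?u (?y - sum ?u I). sum c W + card I \<le> real (t + card W)))"
    by (rule alternating_sum_weights_truncate[OF W(1)]) simp
  also have "\<dots> = (\<Sum>I\<in>Pow W. Poly_Mapping.lookup (?f I) m)"
  proof (rule sum.cong)
    fix I assume "I \<in> Pow W"
    then have I: "I \<subseteq> lattice_points" "finite I" "card I \<le> card W"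
      using W by (auto intro: finite_subset card_mono)
    let ?S = "(*\<^sub>R) (real (t + card W - card I)) ` (convex hull V)"
    have bd: "bounded ?S"
      using V(1) by (intro bounded_scaling bounded_convex_hull finite_imp_bounded)
    have "Poly_Mapping.lookup (?f I) m =
        (-1) ^ card I * Poly_Mapping.lookup (lmonom (\<Sum>I) * lattice_poly ?S) m"
      using I by (cases "even (card I)") (simp_all add: lmonom_sum)
    also have "Poly_Mapping.lookup (lmonom (\<Sum>I) * lattice_poly ?S) m
        = of_bool (exponent_vec m - \<Sum>I \<in> ?S)"
      unfolding lookup_lmonom_mult lookup_lattice_poly[OF bd]
      by (intro point_series_shift lattice_points_sum I)
    also have "exponent_vec m - \<Sum>I \<in> ?S \<longleftrightarrow>
        (\<exists>c\<in>weights W ?u (?y - sum ?u I). sum c W + card I \<le> real (t + card W))"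
    proof -
      have eq: "exponent_vec m - \<Sum>I - real (t + card W - card I) *\<^sub>R v = ?y - sum ?u I"
        using I by (simp add: of_nat_diff sum_subtractf scaleR_diff_left sum_constant_scaleR
            del: sum_constant)
      have "s \<le> real (t + card W - card I) \<longleftrightarrow> s + card I \<le> real (t + card W)" for s
        using I by (simp add: of_nat_diff le_diff_eq)
      then show ?thesis
        unfolding mem_dilate_iff_weights[OF V(1) v] eq W_def[symmetric] by simp
    qed
    finally show "(-1) ^ card I * of_bool (\<exists>c\<in>weights W ?u (?y - sum ?u I).
        sum c W + card I \<le> real (t + card W)) = Poly_Mapping.lookup (?f I) m"
      by simp
  qed simp
  finally show "series_mult (lmonom v ^ t * (\<Prod>w\<in>W. lmonom v - lmonom w))
      (point_series {x. weights W ?u x \<noteq> {}}) m = Poly_Mapping.lookup (\<Sum>I\<in>Pow W. ?f I) m"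
    by (simp add: lookup_sum)
qed

subsection \<open>Brion's identity\<close>

text \<open>The sum has degree less than \<open>card V\<close> and takes the value 1 at the
  \<open>card V\<close> distinct nodes.\<close>

lemma lagrange_sum_eq_1:
  fixes X :: "'b \<Rightarrow> 'k::field"
  assumes V: "finite V" "V \<noteq> {}" "inj_on X V"
  shows "(\<Sum>v\<in>V. smult (1 / (\<Prod>w\<in>V - {v}. X v - X w)) (\<Prod>w\<in>V - {v}. monom 1 1 - [:X w:])) = 1"
    (is "(\<Sum>v\<in>V. ?L v) = 1")
proof (rule poly_eqI_degree)
  fix x assume "x \<in> X ` V"
  then obtain u where u: "u \<in> V" "x = X u" by blast
  have "poly (?L v) x = of_bool (v = u)" if v: "v \<in> V" for v
  proof (cases "v = u")
    case True
    have "(\<Prod>w\<in>V - {u}. X u - X w) \<noteq> 0"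
      using V u by (auto simp: inj_on_def)
    then show ?thesis using True u by (simp add: poly_prod poly_monom)
  next
    case False
    then have "(\<Prod>w\<in>V - {v}. X u - X w) = 0"
      using V(1) u by (intro prod_zero) auto
    then show ?thesis using False u by (simp add: poly_prod poly_monom)
  qed
  then have "poly (\<Sum>v\<in>V. ?L v) x = (\<Sum>v\<in>V. of_bool (v = u))"
    unfolding poly_sum by (intro sum.cong) auto
  then show "poly (\<Sum>v\<in>V. ?L v) x = poly 1 x" using V(1) u by simp
next
  have card: "card (X ` V) = card V" "card V > 0"
    using V by (auto simp: card_image card_gt_0_iff)
  have "degree (?L v) \<le> card V - 1" if v: "v \<in> V" for v
  proof -
    have "degree (\<Prod>w\<in>V - {v}. monom 1 1 - [:X w:]) \<le> (\<Sum>w\<in>V - {v}. degree (monom 1 1 - [:X w:]))"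
      using degree_prod_sum_le[of "V - {v}"] V(1) by (simp add: comp_def)
    also have "\<dots> \<le> (\<Sum>w\<in>V - {v}. 1)"
      by (intro sum_mono degree_diff_le) (simp_all add: degree_monom_le)
    finally show ?thesis
      using V(1) v by (intro order_trans[OF degree_smult_le]) simp
  qed
  then have "degree (\<Sum>v\<in>V. ?L v) \<le> card V - 1"
    by (rule degree_sum_le[OF V(1)])
  then show "degree (\<Sum>v\<in>V. ?L v) < card (X ` V)" using card by simp
  show "degree (1 :: 'k poly) < card (X ` V)" using card by simp
qed

text \<open>The linear functional replacing the \<open>j\<close>-th power of the variable by
  \<open>a (t + j)\<close> is applied to \<open>lagrange_sum_eq_1\<close>. The constant 1 yields
  \<open>a t\<close>, and the expanded basis numerators yield the alternating sums.\<close>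

lemma lagrange_shift:
  fixes X :: "'b \<Rightarrow> 'k::field"
  assumes V: "finite V" "V \<noteq> {}" "inj_on X V"
  shows "(\<Sum>v\<in>V. (\<Sum>I\<in>Pow (V - {v}). (-1) ^ card I * prod X I * a (t + card (V - {v}) - card I))
    / (\<Prod>w\<in>V - {v}. X v - X w)) = a t"
proof -
  \<comment> \<open>Stopping before \<open>card V\<close> loses nothing, since each basis numerator
    has degree \<open>card V - 1\<close>.\<close>
  define \<Phi> where "\<Phi> p = (\<Sum>j<card V. coeff p j * a (t + j))" for p
  have sum: "\<Phi> (sum f A) = (\<Sum>x\<in>A. \<Phi> (f x))" for f :: "'c \<Rightarrow> 'k poly" and A
    unfolding \<Phi>_def coeff_sum sum_distrib_right by (rule sum.swap)
  have smult: "\<Phi> (smult c p) = c * \<Phi> p" for c p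
    by (simp add: \<Phi>_def sum_distrib_left mult.assoc)
  have monom: "\<Phi> (monom c k) = c * a (t + k)" if "k < card V" for c k
  proof -
    have "\<Phi> (monom c k) = (\<Sum>j<card V. if j = k then c * a (t + j) else 0)"
      unfolding \<Phi>_def by (intro sum.cong) auto
    then show ?thesis using that by simp
  qed
  have prod: "\<Phi> (\<Prod>w\<in>V - {v}. monom 1 1 - [:X w:])
      = (\<Sum>I\<in>Pow (V - {v}). (-1) ^ card I * prod X I * a (t + card (V - {v}) - card I))"
    if v: "v \<in> V" for v
  proof -
    let ?W = "V - {v}"
    have W: "finite ?W" "card ?W < card V"
      using V v by (simp, intro psubset_card_mono) auto
    have "(\<Prod>w\<in>?W. monom 1 1 - [:X w:])
        = (\<Sum>I\<in>Pow ?W. (-1) ^ card I * (\<Prod>w\<in>I. [:X w:]) * (\<Prod>w\<in>?W - I. monom 1 1))"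
      by (rule prod_diff_conv_sum[OF W(1)])
    also have "\<dots> = (\<Sum>I\<in>Pow ?W. monom ((-1) ^ card I * prod X I) (card ?W - card I))"
    proof (rule sum.cong)
      fix I assume "I \<in> Pow ?W"
      then have I: "finite I" "I \<subseteq> ?W" using W(1) by (auto intro: finite_subset)
      then have "(\<Prod>w\<in>?W - I. monom 1 1) = (monom 1 (card ?W - card I) :: 'k poly)"
        by (simp add: monom_power card_Diff_subset)
      moreover have "(-1) ^ card I * (\<Prod>w\<in>I. [:X w:]) = [:(-1) ^ card I * prod X I:]"
        by (cases "even (card I)") (simp_all add: prod_to_poly)
      ultimately show "(-1) ^ card I * (\<Prod>w\<in>I. [:X w:]) * (\<Prod>w\<in>?W - I. monom 1 1)
          = monom ((-1) ^ card I * prod X I) (card ?W - card I)"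
        by (simp add: smult_monom)
    qed simp
    finally have "\<Phi> (\<Prod>w\<in>?W. monom 1 1 - [:X w:])
        = (\<Sum>I\<in>Pow ?W. (-1) ^ card I * prod X I * a (t + (card ?W - card I)))"
      using W by (simp add: sum monom)
    also have "\<dots> = (\<Sum>I\<in>Pow ?W. (-1) ^ card I * prod X I * a (t + card ?W - card I))"
      using W(1) by (intro sum.cong) (auto simp: card_mono)
    finally show ?thesis .
  qed
  have "a t = \<Phi> 1"
  proof -
    have "card V > 0" using V by (simp add: card_gt_0_iff)
    then show ?thesis using monom[of 0 1] by (simp add: monom_0 one_pCons)
  qed
  also have "\<dots> = (\<Sum>v\<in>V. (1 / (\<Prod>w\<in>V - {v}. X v - X w)) * \<Phi> (\<Prod>w\<in>V - {v}. monom 1 1 - [:X w:]))"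
    by (simp only: sum smult flip: lagrange_sum_eq_1[OF V])
  finally show ?thesis using prod by simp
qed

lemma to_fract_prod: "to_fract (prod f A) = (\<Prod>x\<in>A. to_fract (f x))"
  by (induction A rule: infinite_finite_induct) simp_all

lemma to_fract_power: "to_fract (x ^ n) = to_fract x ^ n"
  by (induction n) simp_all

lemma lmonom_neq_0: "lmonom v \<noteq> 0"
  by (metis lmonom_def lookup_single_eq lookup_zero zero_neq_one)

text \<open>By \<open>cone_transform_dilates\<close> each summand is a Lagrange numerator, with
  powers replaced by lattice polynomials of dilates, over the product of node differences. Then
  \<open>lagrange_shift\<close> sums them.\<close>

lemma brion:
  fixes V :: "(real^'n::{finite,linorder}) set"
  assumes V: "finite V" "V \<noteq> {}" "V \<subseteq> lattice_points"
  shows "to_fract (lattice_poly ((*\<^sub>R) (real t) ` (convex hull V))) =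
    (\<Sum>v\<in>V. to_fract (lmonom v ^ t) *
      integer_point_transform {x. weights (V - {v}) (\<lambda>w. w - v) x \<noteq> {}})"
proof -
  define a where "a k = to_fract (lattice_poly ((*\<^sub>R) (real k) ` (convex hull V)))" for k
  let ?X = "\<lambda>v. to_fract (lmonom v)"
  have inj: "inj_on ?X V"
    using V(3) lmonom_eq_iff by (auto simp: inj_on_def)
  have cone: "to_fract (lmonom v ^ t) * integer_point_transform {x. weights (V - {v}) (\<lambda>w. w - v) x \<noteq> {}}
      = (\<Sum>I\<in>Pow (V - {v}). (-1) ^ card I * prod ?X I * a (t + card (V - {v}) - card I))
        / (\<Prod>w\<in>V - {v}. ?X v - ?X w)" if v: "v \<in> V" for v
  proof -
    have "lmonom v - lmonom w \<noteq> 0" if "w \<in> V - {v}" for w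
      using that v V(3) lmonom_eq_iff[of v w] by auto
    then have "lmonom v ^ t * (\<Prod>w\<in>V - {v}. lmonom v - lmonom w) \<noteq> 0"
      using V(1) by (simp add: lmonom_neq_0)
    note transform = integer_point_transform_eqI[OF this cone_transform_dilates[OF V(1,3) v]]
    have "to_fract (\<Sum>I\<in>Pow (V - {v}). (-1) ^ card I * prod lmonom I *
        lattice_poly ((*\<^sub>R) (real (t + card (V - {v}) - card I)) ` (convex hull V)))
      = (\<Sum>I\<in>Pow (V - {v}). (-1) ^ card I * prod ?X I * a (t + card (V - {v}) - card I))"
      unfolding to_fract_sum
      by (intro sum.cong) (simp_all only: to_fract_mult to_fract_power to_fract_prod to_fract_uminus
          to_fract_1 a_def)
    then show ?thesis
      unfolding transform Fract_conv_to_fract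
      by (simp add: to_fract_prod lmonom_neq_0)
  qed
  have "a t = (\<Sum>v\<in>V. to_fract (lmonom v ^ t) *
      integer_point_transform {x. weights (V - {v}) (\<lambda>w. w - v) x \<noteq> {}})"
    unfolding lagrange_shift[OF V(1,2) inj, of a t, symmetric]
    by (intro sum.cong cone[symmetric]) simp_all
  then show ?thesis by (simp only: a_def)
qed

subsection \<open>Specialization of the identity\<close>

lemma rat_const_1 [simp]: "rat_const 1 = 1"
  by (simp add: rat_const_def flip: one_pCons)

lemma laurent_eval_1: "laurent_eval z 1 = 1"
  using laurent_eval_single[of z 0 1] by simp

text \<open>Evaluation is only available for fractions with a representation regular at
  \<open>z\<close>. The sum is therefore brought to a common denominator, a product of nonvanishing
  ones, and compared with \<open>a\<close> after clearing it.\<close>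

lemma laurent_eval_sum_Fract:
  assumes z: "\<And>i. z i \<noteq> 0" and "finite V"
    and g: "\<And>v. v \<in> V \<Longrightarrow> laurent_eval z (g v) \<noteq> 0"
    and a: "to_fract a = (\<Sum>v\<in>V. Fraction_Field.Fract (f v) (g v))"
  shows "laurent_eval z a = (\<Sum>v\<in>V. laurent_eval z (f v) / laurent_eval z (g v))"
proof -
  have "\<exists>F G. (\<Sum>v\<in>V. Fraction_Field.Fract (f v) (g v)) = Fraction_Field.Fract F G \<and>
      laurent_eval z G \<noteq> 0 \<and>
      (\<Sum>v\<in>V. laurent_eval z (f v) / laurent_eval z (g v)) = laurent_eval z F / laurent_eval z G"
    using \<open>finite V\<close> g
  proof (induction V)
    case empty
    show ?case
      by (intro exI[of _ 0] exI[of _ 1]) (simp add: laurent_eval_1 laurent_eval_def Fract_conv_to_fract)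
  next
    case (insert v V)
    then obtain F G where FG: "(\<Sum>v\<in>V. Fraction_Field.Fract (f v) (g v)) = Fraction_Field.Fract F G"
      "laurent_eval z G \<noteq> 0"
      "(\<Sum>v\<in>V. laurent_eval z (f v) / laurent_eval z (g v)) = laurent_eval z F / laurent_eval z G"
      by auto
    have gv: "laurent_eval z (g v) \<noteq> 0" using insert.prems by simp
    then have "G \<noteq> 0" "g v \<noteq> 0" using FG(2) by (auto simp: laurent_eval_def)
    then show ?case
      using insert.hyps FG gv
      by (intro exI[of _ "f v * G + F * g v"] exI[of _ "g v * G"])
        (simp add: laurent_eval_add laurent_eval_mult[OF z] add_frac_eq)
  qed
  then obtain F G where FG: "to_fract a = Fraction_Field.Fract F G" "laurent_eval z G \<noteq> 0"
    "(\<Sum>v\<in>V. laurent_eval z (f v) / laurent_eval z (g v)) = laurent_eval z F / laurent_eval z G"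
    using a by metis
  then have "G \<noteq> 0" by (auto simp: laurent_eval_def)
  then have "to_fract (a * G) = to_fract F"
    using FG(1) by (simp add: Fract_conv_to_fract)
  then have "a * G = F" unfolding to_fract_eq_iff .
  then have "laurent_eval z a * laurent_eval z G = laurent_eval z F"
    using laurent_eval_mult[of z a G] z by simp
  then have "laurent_eval z a = laurent_eval z F / laurent_eval z G"
    using FG(2) by (simp add: eq_divide_eq)
  then show ?thesis using FG(3) by simp
qed

section \<open>Powers of \<open>q\<close> and the specialization point\<close>

lemma qvar_neq_0: "qvar \<noteq> 0"
  by (simp add: qvar_def)

lemma qvar_power_eq_1_iff: "qvar ^ n = 1 \<longleftrightarrow> n = 0"
proof
  assume "qvar ^ n = 1"
  then have "to_fract ([:0, 1:] ^ n :: rat poly) = to_fract 1"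
    by (simp add: qvar_def to_fract_power)
  then have "[:0, 1:] ^ n = (1 :: rat poly)" unfolding to_fract_eq_iff .
  then have "degree ([:0, 1:] ^ n :: rat poly) = 0" by simp
  then show "n = 0" by (simp add: degree_linear_power)
qed simp

text \<open>The indeterminate \<open>q\<close> is not a root of unity. This turns genericity of
  \<open>l\<close> into nonvanishing of the specialized denominators.\<close>

lemma qvar_powi_eq_iff: "qvar powi a = qvar powi b \<longleftrightarrow> a = b"
proof -
  have *: "qvar powi a \<noteq> qvar powi b" if "a < b" for a b
  proof
    assume "qvar powi a = qvar powi b"
    then have "qvar powi (b - a) = 1" by (simp add: power_int_diff qvar_neq_0)
    then have "qvar ^ nat (b - a) = 1" using that by (simp add: power_int_def)
    then show False using that by (simp add: qvar_power_eq_1_iff)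
  qed
  show ?thesis using *[of a b] *[of b a] by (metis linorder_less_linear)
qed

lemma power_int_sum:
  fixes x :: "'a::field"
  assumes "x \<noteq> 0"
  shows "x powi (sum f A) = (\<Prod>i\<in>A. x powi f i)"
  using assms by (induction A rule: infinite_finite_induct) (simp_all add: power_int_add)

lemma floor_form_exponent_vec:
  "\<lfloor>form l (exponent_vec m)\<rfloor> = (\<Sum>i\<in>UNIV. l $ i * Poly_Mapping.lookup m i)"
proof -
  have "form l (exponent_vec m) = of_int (\<Sum>i\<in>UNIV. l $ i * Poly_Mapping.lookup m i)"
    by (simp add: form_def exponent_vec_nth)
  then show ?thesis by (simp only: floor_of_int)
qed

abbreviation form_point :: "int^'n \<Rightarrow> 'n \<Rightarrow> rat poly fract" where
  "form_point l \<equiv> \<lambda>i. qvar powi (l $ i)"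

lemma prod_form_point:
  "(\<Prod>i\<in>UNIV. form_point l i powi Poly_Mapping.lookup m i) = qvar powi \<lfloor>form l (exponent_vec m)\<rfloor>"
  by (simp add: floor_form_exponent_vec power_int_sum qvar_neq_0 power_int_mult)

lemma laurent_eval_lmonom:
  "v \<in> lattice_points \<Longrightarrow> laurent_eval (form_point l) (lmonom v) = qvar powi \<lfloor>form l v\<rfloor>"
  by (simp add: lmonom_def laurent_eval_single prod_form_point exponent_vec_exponent)

lemma laurent_eval_lattice_poly:
  assumes "bounded S"
  shows "laurent_eval (form_point l) (lattice_poly S)
    = (\<Sum>x\<in>S \<inter> lattice_points. qvar powi \<lfloor>form l x\<rfloor>)"
proof -
  let ?M = "{m. exponent_vec m \<in> S}"
  have "Poly_Mapping.keys (lattice_poly S) = ?M"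
    by (auto simp: in_keys_iff lookup_lattice_poly[OF assms] point_series_def split: if_splits)
  then have "laurent_eval (form_point l) (lattice_poly S)
      = (\<Sum>m\<in>?M. qvar powi \<lfloor>form l (exponent_vec m)\<rfloor>)"
    unfolding laurent_eval_def prod_form_point
    by (intro sum.cong)
      (simp_all add: lookup_lattice_poly[OF assms] point_series_def)
  also have "\<dots> = (\<Sum>x\<in>S \<inter> lattice_points. qvar powi \<lfloor>form l x\<rfloor>)"
  proof (rule sum.reindex_bij_betw)
    show "bij_betw exponent_vec ?M (S \<inter> lattice_points)"
      by (intro bij_betwI[where g = exponent])
        (auto simp: exponent_vec_in_lattice_points exponent_exponent_vec exponent_vec_exponent)
  qed
  finally show ?thesis .
qed

lemma floor_form_eq_iff:
  assumes "v \<in> lattice_points" "w \<in> lattice_points"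
  shows "\<lfloor>form l v\<rfloor> = \<lfloor>form l w\<rfloor> \<longleftrightarrow> form l v = form l w"
proof -
  have "form l x \<in> \<int>" if "x \<in> lattice_points" for x
    using that by (auto simp: form_def lattice_points_def)
  then show ?thesis using assms by (metis floor_of_int Ints_cases)
qed

lemma lattice_polytope_vertices:
  assumes "lattice_polytope P"
  shows "finite (vertices P)" "vertices P \<subseteq> lattice_points" "convex hull vertices P = P"
proof -
  obtain V where V: "finite V" "V \<subseteq> lattice_points" "P = convex hull V"
    using assms by (auto simp: lattice_polytope_def)
  have "vertices P \<subseteq> V"
    unfolding vertices_def V(3) by (auto simp: extreme_point_of_convex_hull)
  then show "finite (vertices P)" "vertices P \<subseteq> lattice_points"
    using V finite_subset by auto
  show "convex hull vertices P = P"
    unfolding vertices_def V(3) using Krein_Milman_polytope[OF V(1)] by simp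
qed

lemma laurent_eval_prod:
  assumes "\<And>i. z i \<noteq> 0"
  shows "laurent_eval z (prod f A) = (\<Prod>x\<in>A. laurent_eval z (f x))"
  by (induction A rule: infinite_finite_induct) (simp_all add: laurent_eval_1 laurent_eval_mult[OF assms])

lemma laurent_eval_diff: "laurent_eval z (f - g) = laurent_eval z f - laurent_eval z g"
  using laurent_eval_add[of z "f - g" g] by simp

text \<open>Genericity separates the values of \<open>l\<close> only along edges, so the denominator
  must be the product over the neighbours of \<open>v\<close>; the product over all other vertices
  could vanish at the specialization.\<close>

lemma rho_regular:
  fixes P :: "(real^'n::{finite,linorder}) set"
  assumes P: "lattice_polytope P" "generic_positive l P" and v: "v \<in> vertices P"
  obtains f g where "integer_point_transform (vertex_cone P v) = Fraction_Field.Fract f g"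
    "laurent_eval (form_point l) g \<noteq> 0"
    "rho P l v = laurent_eval (form_point l) f / laurent_eval (form_point l) g"
proof -
  let ?A = "{w. adjacent_vertices P v w}"
  note V = lattice_polytope_vertices[OF P(1)]
  define g where "g = (\<Prod>w\<in>?A. lmonom v - lmonom w)"
  have z: "form_point l i \<noteq> 0" for i by (simp add: qvar_neq_0)
  have A: "?A \<subseteq> vertices P" by (auto simp: adjacent_vertices_def)
  then have finA: "finite ?A" and AL: "?A \<subseteq> lattice_points" and vL: "v \<in> lattice_points"
    using V v finite_subset by auto
  have "laurent_eval (form_point l) (lmonom v - lmonom w) \<noteq> 0" if "w \<in> ?A" for w
  proof -
    have "w \<in> lattice_points" "form l v \<noteq> form l w"
      using that AL P(2) by (auto simp: generic_positive_def)
    then show ?thesis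
      using vL by (simp add: laurent_eval_diff laurent_eval_lmonom qvar_powi_eq_iff floor_form_eq_iff)
  qed
  then have g: "laurent_eval (form_point l) g \<noteq> 0"
    using finA by (simp add: g_def laurent_eval_prod[OF z])
  then have "g \<noteq> 0" by (auto simp: laurent_eval_def)
  have "vertex_cone P v = {x. weights ?A (\<lambda>w. w - v) x \<noteq> {}}"
    using vertex_cone_conv_weights[OF finA] by blast
  then obtain f where "series_mult g (point_series (vertex_cone P v)) = Poly_Mapping.lookup f"
    using cone_transform_polynomial[OF finA AL vL] by (auto simp: g_def)
  then have ipt: "integer_point_transform (vertex_cone P v) = Fraction_Field.Fract f g"
    using \<open>g \<noteq> 0\<close> integer_point_transform_eqI by blast
  then have "rho P l v = laurent_eval (form_point l) f / laurent_eval (form_point l) g"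
    using ratfun_eval_Fract[of "form_point l", OF z g] by (simp add: rho_def)
  with ipt g show thesis by (rule that)
qed

lemma ehr_eq_sum_rho:
  fixes P :: "(real^'n::{finite,linorder}) set"
  assumes P: "lattice_polytope P" "generic_positive l P"
  shows "ehr P l t = (\<Sum>v\<in>vertices P. rho P l v * (qvar ^ t) ^ nat \<lfloor>form l v\<rfloor>)"
proof (cases "vertices P = {}")
  \<comment> \<open>For the empty polytope both sides are empty sums; \<open>brion\<close> needs at
    least one vertex.\<close>
  case True
  then have "P = {}" using lattice_polytope_vertices(3)[OF P(1)] by simp
  with True show ?thesis by (simp add: ehr_def)
next
  case False
  note V = lattice_polytope_vertices[OF P(1)]
  let ?ev = "laurent_eval (form_point l)" and ?S = "(*\<^sub>R) (real t) ` P"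
  have z: "form_point l i \<noteq> 0" for i by (simp add: qvar_neq_0)
  have bd: "bounded ?S"
    using V by (metis bounded_scaling bounded_convex_hull finite_imp_bounded)
  have "\<forall>v\<in>vertices P. \<exists>fg. integer_point_transform (vertex_cone P v) = Fraction_Field.Fract (fst fg) (snd fg) \<and>
      ?ev (snd fg) \<noteq> 0 \<and> rho P l v = ?ev (fst fg) / ?ev (snd fg)"
    using rho_regular[OF P] by (metis fst_conv snd_conv)
  then obtain fg where fg: "\<And>v. v \<in> vertices P \<Longrightarrow>
      integer_point_transform (vertex_cone P v) = Fraction_Field.Fract (fst (fg v)) (snd (fg v)) \<and>
      ?ev (snd (fg v)) \<noteq> 0 \<and> rho P l v = ?ev (fst (fg v)) / ?ev (snd (fg v))"
    by metis
  \<comment> \<open>\<open>brion\<close> takes the directions to all other vertices. The edge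
    directions span the same cone, so its transform may be replaced by the regular fraction
    \<open>fg v\<close>.\<close>
  have "vertex_cone P v = {x. weights (vertices P - {v}) (\<lambda>w. w - v) x \<noteq> {}}" if "v \<in> vertices P" for v
    using adjacent_vertices_generate[OF V(3,1) that] by blast
  then have "to_fract (lattice_poly ?S) =
      (\<Sum>v\<in>vertices P. to_fract (lmonom v ^ t) * integer_point_transform (vertex_cone P v))"
    using brion[OF V(1) False V(2), of t] unfolding V(3) by simp
  also have "\<dots> = (\<Sum>v\<in>vertices P. Fraction_Field.Fract (lmonom v ^ t * fst (fg v)) (snd (fg v)))"
    using fg by (intro sum.cong) (simp_all add: Fract_conv_to_fract)
  finally have "?ev (lattice_poly ?S) =
      (\<Sum>v\<in>vertices P. ?ev (lmonom v ^ t * fst (fg v)) / ?ev (snd (fg v)))"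
    using fg by (intro laurent_eval_sum_Fract[OF z V(1)]) auto
  also have "\<dots> = (\<Sum>v\<in>vertices P. rho P l v * (qvar ^ t) ^ nat \<lfloor>form l v\<rfloor>)"
  proof (rule sum.cong)
    fix v assume v: "v \<in> vertices P"
    \<comment> \<open>Positivity of \<open>l\<close> lets the integer power of \<open>q\<close> be
      read as a natural power.\<close>
    then have nn: "0 \<le> \<lfloor>form l v\<rfloor>" using P(2) by (simp add: generic_positive_def)
    have "?ev (lmonom v ^ t) = ?ev (lmonom v) ^ t"
      using laurent_eval_prod[of "form_point l" "\<lambda>_. lmonom v" "{..<t}", OF z] by simp
    also have "?ev (lmonom v) = qvar powi \<lfloor>form l v\<rfloor>"
      using v V(2) by (intro laurent_eval_lmonom) auto
    also have "\<dots> = qvar ^ nat \<lfloor>form l v\<rfloor>"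
      using nn by (simp add: power_int_def)
    also have "(qvar ^ nat \<lfloor>form l v\<rfloor>) ^ t = (qvar ^ t) ^ nat \<lfloor>form l v\<rfloor>"
      by (simp add: mult.commute flip: power_mult)
    finally show "?ev (lmonom v ^ t * fst (fg v)) / ?ev (snd (fg v))
        = rho P l v * (qvar ^ t) ^ nat \<lfloor>form l v\<rfloor>"
      using fg[OF v] by (simp add: laurent_eval_mult[of "form_point l", OF z])
  qed simp
  finally show ?thesis by (simp add: ehr_def laurent_eval_lattice_poly[OF bd])
qed

theorem theorem1p3:
  fixes P :: "(real^('n::{finite,linorder})) set" and l :: "int^('n::{finite,linorder})"
  assumes "lattice_polytope P"
    and "generic_positive l P"
  shows "(\<forall>t::nat. t > 0 \<longrightarrow>
            ehr P l t =
              (\<Sum>v\<in>vertices P. rho P l v * ((qvar - 1) * qbracket t + 1) ^ nat \<lfloor>form l v\<rfloor>)) \<and>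
         (\<forall>t::nat. t > 0 \<longrightarrow> poly (chi P l) (qbracket t) = ehr P l t)"
proof -
  have "qvar \<noteq> 1" using qvar_power_eq_1_iff[of 1] by simp
  \<comment> \<open>Since \<open>q\<close> differs from 1, the denominator of
    \<open>qbracket t\<close> cancels and both claims reduce to
    \<open>ehr_eq_sum_rho\<close>.\<close>
  then have q: "(qvar - 1) * qbracket t + 1 = qvar ^ t" for t
    by (simp add: qbracket_def)
  have "poly (chi P l) (qbracket t)
      = (\<Sum>v\<in>vertices P. rho P l v * ((qvar - 1) * qbracket t + 1) ^ nat \<lfloor>form l v\<rfloor>)" for t
    by (simp add: chi_def poly_sum algebra_simps)
  then show ?thesis
    using ehr_eq_sum_rho[OF assms] by (simp only: q simp_thms)
qed

end
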